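(* Let $m, r$ and $d$ be integers such that $d \geq 1$ and $2 \leq 2r \leq m-1$. Then $$ \overline{\mathcal{A}\left(\left\lceil \tfrac{d}{2}\right\rceil,\ldots,\left\lceil \tfrac{d}{2}\right\rceil\right)} = \overline{\mathcal{G}^{ss}_{d,2r,m}} = \mathrm{POL}^{ss}_{d,2r,m}, $$ where $\lceil d/2\rceil$ appears $r$ times as an argument of $\mathcal{A}$.
   Context: All matrix polynomials have coefficients in $\mathbb{C}$. A matrix polynomial has grade $d$ if its degree is at most $d$ (the zero polynomial is allowed). $\mathrm{POL}^{p\times q}$ is the set of all $p\times q$ matrix polynomials (no grade specified), and $\mathrm{POL}^{p\times q}_{d}$ is the vector space of those of grade $d$. $\mathrm{POL}^{ss}_{d,m}$ is the vector space of $m\times m$ skew-symmetric matrix polynomials $P(\lambda)=\sum_{i=0}^d\lambda^i A_i$, $A_i\in\mathbb{C}^{m\times m}$, $A_i^T=-A_i$. The (normal) rank of a matrix polynomial is its rank over the field $\mathbb{C}(\lambda)$. $\mathrm{POL}^{ss}_{d,2r,m}$ is the set of $P\in \mathrm{POL}^{ss}_{d,m}$ with normal rank at most $2r$. $\mathrm{POL}^{ss}_{d,m}$ carries the distance $d(P,P')=\left(\sum_{i=0}^d\|A_i-A_i'\|_F^2\right)^{1/2}$, where $P=\sum_{i=0}^d \lambda^iA_i$ and $P'=\sum_{i=0}^d \lambda^iA_i'$, and $\overline{\mathcal{S}}$ denotes closure in the resulting (Euclidean) topology. The set $\mathcal{G}^{ss}_{d,2r,m}$ is $$ \mathcal{G}^{ss}_{d,2r,m}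 := \left\{ U(\lambda) V(\lambda)^T - V(\lambda) U(\lambda)^T \; : \; V(\lambda) \in \mathrm{POL}^{m\times r}_{\lceil d/2 \rceil},\; U(\lambda) \in \mathrm{POL}^{m\times r}_{\lfloor d/2 \rfloor} \right\}. $$ $\Delta_r$ is the $r\times r$ matrix with ones on the anti-diagonal and zeros elsewhere. For a matrix polynomial $L(\lambda)$, $L_{*i}$ denotes its $i$-th column; the degree of a vector polynomial is the largest power of $\lambda$ with a nonzero vector coefficient (so a vector polynomial whose degree is a nonnegative integer is nonzero). For integers $d_1,\ldots,d_r$ with $d\ge d_i\ge d/2$ for $i=1,\ldots,r$, $$ \mathcal{A}(d_1,\ldots,d_r) := \left\{ L(\lambda)\begin{bmatrix} 0 & \Delta_r\\ -\Delta_r & 0\end{bmatrix} L(\lambda)^T \; : \; \begin{array}{l} L(\lambda)\in\mathrm{POL}^{m\times 2r},\\ \deg(L_{*i})=d_i \text{ and } \deg(L_{*(2r-i+1)})=d-d_i \text{ for } i=1,\ldots,r\end{array}\right\}. $$ *)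

theory Defs
  imports
    "HOL-Analysis.Abstract_Metric_Spaces"
    "Jordan_Normal_Form.DL_Rank"
    "HOL-Computational_Algebra.Polynomial_Factorial"
begin

text \<open>A matrix polynomial is represented as a matrix over \<open>\<complex>[\<lambda>]\<close>, i.e. of type
  \<^typ>\<open>complex poly mat\<close>. Indices of rows and columns start at 0.\<close>

text \<open>The matrix coefficient \<open>A\<^sub>i\<close> of \<open>P(\<lambda>) = \<Sum>\<^sub>i \<lambda>\<^sup>i A\<^sub>i\<close>.\<close>

definition mat_coeff :: "complex poly mat \<Rightarrow> nat \<Rightarrow> complex mat" where
  "mat_coeff P i = map_mat (\<lambda>p. coeff p i) P"

definition POL :: "nat \<Rightarrow> nat \<Rightarrow> complex poly mat set" where
  "POL p q = carrier_mat p q"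

definition POL_grade :: "nat \<Rightarrow> nat \<Rightarrow> nat \<Rightarrow> complex poly mat set" where
  "POL_grade d p q = {P \<in> POL p q. \<forall>i>d. mat_coeff P i = 0\<^sub>m p q}"

definition POL_ss :: "nat \<Rightarrow> nat \<Rightarrow> complex poly mat set" where
  "POL_ss d m =
    {P \<in> POL_grade d m m. \<forall>i\<le>d. transpose_mat (mat_coeff P i) = - mat_coeff P i}"

text \<open>\<^typ>\<open>complex poly fract\<close> is the field \<open>\<complex>(\<lambda>)\<close> of rational functions.\<close>

definition normal_rank :: "complex poly mat \<Rightarrow> nat" where
  "normal_rank P = vec_space.rank (dim_row P) (map_mat to_fract P)"

text \<open>The second argument is the bound on the rank itself, so it is instantiated with \<open>2 * r\<close>.\<close>

definition POL_ss_rank :: "nat \<Rightarrow> nat \<Rightarrow> nat \<Rightarrow> complex poly mat set" where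
  "POL_ss_rank d k m = {P \<in> POL_ss d m. normal_rank P \<le> k}"

text \<open>The two inner sums are the squared Frobenius norm of the difference of the \<open>i\<close>-th
  coefficients. It is written out entrywise because \<^locale>\<open>Metric_space\<close> demands symmetry of
  the distance also outside of the carrier, where the dimensions of \<open>P\<close> and \<open>P'\<close> may differ.\<close>

definition pol_dist :: "nat \<Rightarrow> nat \<Rightarrow> complex poly mat \<Rightarrow> complex poly mat \<Rightarrow> real" where
  "pol_dist d m P P' =
    sqrt (\<Sum>i\<le>d. \<Sum>j<m. \<Sum>k<m. (cmod (mat_coeff P i $$ (j, k) - mat_coeff P' i $$ (j, k)))\<^sup>2)"

lemma pol_dist_L2_set:
  "pol_dist d m P P' =
    L2_set (\<lambda>(i, j, k). cmod (mat_coeff P i $$ (j, k) - mat_coeff P' i $$ (j, k)))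
      ({..d} \<times> {..<m} \<times> {..<m})"
  by (simp add: pol_dist_def L2_set_def sum.cartesian_product case_prod_unfold)

lemma pol_dist_eq_0_iff:
  assumes "P \<in> POL_ss d m" "P' \<in> POL_ss d m"
  shows "pol_dist d m P P' = 0 \<longleftrightarrow> P = P'"
proof
  assume *: "pol_dist d m P P' = 0"
  have dims: "P \<in> carrier_mat m m" "P' \<in> carrier_mat m m"
    using assms by (auto simp: POL_ss_def POL_grade_def POL_def)
  have low: "mat_coeff P i $$ (j, k) = mat_coeff P' i $$ (j, k)"
    if "i \<le> d" "j < m" "k < m" for i j k
  proof -
    have "\<forall>x\<in>{..d} \<times> {..<m} \<times> {..<m}.
        (case x of (i, j, k) \<Rightarrow> cmod (mat_coeff P i $$ (j, k) - mat_coeff P' i $$ (j, k))) = 0"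
      using * unfolding pol_dist_L2_set by (subst (asm) L2_set_eq_0_iff) auto
    with that show ?thesis by fastforce
  qed
  have high: "mat_coeff P i = mat_coeff P' i" if "i > d" for i
    using assms that by (auto simp: POL_ss_def POL_grade_def)
  show "P = P'"
  proof (rule eq_matI)
    fix j k assume "j < dim_row P'" "k < dim_col P'"
    then have jk: "j < m" "k < m" using dims by auto
    show "P $$ (j, k) = P' $$ (j, k)"
    proof (rule poly_eqI)
      fix i
      have "mat_coeff P i $$ (j, k) = mat_coeff P' i $$ (j, k)"
        using low[of i j k] high[of i] jk by (cases "i \<le> d") auto
      then show "coeff (P $$ (j, k)) i = coeff (P' $$ (j, k)) i"
        using jk dims by (simp add: mat_coeff_def)
    qed
  qed (use dims in auto)
qed (simp add: pol_dist_def)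

lemma Metric_space_POL_ss: "Metric_space (POL_ss d m) (pol_dist d m)"
proof
  fix P Q R :: "complex poly mat"
  let ?I = "{..d} \<times> {..<m} \<times> {..<m}"
  show "0 \<le> pol_dist d m P Q"
    by (simp add: pol_dist_L2_set)
  show "pol_dist d m P Q = pol_dist d m Q P"
    by (simp add: pol_dist_def norm_minus_commute)
  show "pol_dist d m P R \<le> pol_dist d m P Q + pol_dist d m Q R"
    unfolding pol_dist_L2_set
    by (rule order.trans[OF L2_set_mono L2_set_triangle_ineq])
       (auto intro: norm_diff_triangle_ineq norm_diff_triangle_le)
qed (rule pol_dist_eq_0_iff)

text \<open>The closure in the topology that the distance induces on \<open>POL_ss d m\<close>; the locale
  assumptions are discharged by \<open>Metric_space_POL_ss\<close>.\<close>

definition pol_closure :: "nat \<Rightarrow> nat \<Rightarrow> complex poly mat set \<Rightarrow> complex poly mat set" where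
  "pol_closure d m S = Metric_space.mtopology (POL_ss d m) (pol_dist d m) closure_of S"

definition G_ss :: "nat \<Rightarrow> nat \<Rightarrow> nat \<Rightarrow> complex poly mat set" where
  "G_ss d r m =
    {U * transpose_mat V - V * transpose_mat U | U V.
      V \<in> POL_grade (nat \<lceil>real d / 2\<rceil>) m r \<and> U \<in> POL_grade (nat \<lfloor>real d / 2\<rfloor>) m r}"

definition antidiag_mat :: "nat \<Rightarrow> complex poly mat" where
  "antidiag_mat r = mat r r (\<lambda>(i, j). if i + j + 1 = r then 1 else 0)"

text \<open>\<open>vec_degree_is v k\<close>: the degree of the vector polynomial \<open>v\<close> is \<open>k\<close>, that is, \<open>k\<close> is the
  largest power with a nonzero vector coefficient. No \<open>k\<close> satisfies it if \<open>v = 0\<close>.\<close>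

definition vec_degree_is :: "complex poly vec \<Rightarrow> nat \<Rightarrow> bool" where
  "vec_degree_is v k \<longleftrightarrow>
    map_vec (\<lambda>p. coeff p k) v \<noteq> 0\<^sub>v (dim_vec v) \<and>
    (\<forall>l>k. map_vec (\<lambda>p. coeff p l) v = 0\<^sub>v (dim_vec v))"

text \<open>The list \<open>ds\<close> is \<open>[d\<^sub>1, \<dots>, d\<^sub>r]\<close>, so \<open>r\<close> is its length. The definition is meant for lists
  with \<open>d / 2 \<le> d\<^sub>i \<le> d\<close> (hence the subtraction \<open>d - d\<^sub>i\<close> does not truncate).
  With indices starting at 0, the column paired with column \<open>i\<close> is \<open>2 * r - 1 - i\<close>.\<close>

definition A_ss :: "nat \<Rightarrow> nat \<Rightarrow> nat list \<Rightarrow> complex poly mat set" where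
  "A_ss d m ds =
    (let r = length ds;
         J = four_block_mat (0\<^sub>m r r) (antidiag_mat r) (- antidiag_mat r) (0\<^sub>m r r)
     in {L * J * transpose_mat L | L.
          L \<in> POL m (2 * r) \<and>
          (\<forall>i<r. vec_degree_is (col L i) (ds ! i) \<and>
                 vec_degree_is (col L (2 * r - 1 - i)) (d - ds ! i))})"

end

theory Submission
  imports Defs "HOL-Computational_Algebra.Fundamental_Theorem_Algebra"
begin

text \<open>
  A skew-symmetric polynomial matrix \<open>P\<close> of grade \<open>d\<close> and rank \<open>2 s\<close> is a sum of \<open>s\<close> bivectors
  \<open>u \<and> v = u v\<^sup>T - v u\<^sup>T\<close> with \<open>deg u + deg v \<le> d\<close>. To see this, attach weights \<open>e\<^sub>i\<close> to the
  indices, initially zero, and keep a skew matrix \<open>M\<close> with \<open>deg M\<^sub>i\<^sub>j \<le> d - e\<^sub>i - e\<^sub>j\<close>. If \<open>M\<close> is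
  singular at a point \<open>x\<close>, let \<open>k\<close> have minimal weight in the support of a kernel vector; a congruence
  makes row and column \<open>k\<close> vanish at \<open>x\<close>, and dividing them by \<open>\<lambda> - x\<close> raises \<open>e\<^sub>k\<close> by one. A
  kernel vector of the matrix of leading coefficients raises a weight in the same way (the point at
  infinity), and an index with \<open>e\<^sub>i > d\<close> carries a zero row and is dropped. When none of this
  applies, the Leibniz formula yields a constant entry \<open>M\<^sub>i\<^sub>j \<noteq> 0\<close> with \<open>e\<^sub>i + e\<^sub>j = d\<close>, which splits
  off one bivector.

  The degrees inside a bivector can be balanced in the limit: if \<open>u = \<lambda>\<^sup>k x + y\<close>, then
  \<open>(x - v / \<epsilon>) \<and> (\<lambda>\<^sup>k v + \<epsilon> y) = u \<and> v + \<epsilon> (x \<and> y)\<close>. Hence every \<open>P\<close> of rank at most \<open>2 r\<close>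
  is a limit of elements of \<open>G_ss\<close>, and a small perturbation makes all column degrees exact. Conversely
  the rank bound is closed, because the factorization provides polynomial matrices \<open>F\<close>, \<open>G\<close> for which
  \<open>det (F P G)\<close> is nonzero, of size the rank of \<open>P\<close>.
\<close>

section \<open>Rank\<close>

lemma rank_mult_le:
  fixes A B :: "'a::field mat"
  assumes A: "A \<in> carrier_mat n k" and B: "B \<in> carrier_mat k l"
  shows "vec_space.rank n (A * B) \<le> vec_space.rank n A"
proof -
  interpret vec_space "TYPE('a)" n .
  have AB: "A * B \<in> carrier_mat n l" using A B by simp
  have cA: "set (cols A) \<subseteq> carrier_vec n" and cAB: "set (cols (A * B)) \<subseteq> carrier_vec n"
    using cols_dim A AB by blast+
  have "set (cols (A * B)) \<subseteq> col_space A"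
  proof
    fix x assume "x \<in> set (cols (A * B))"
    then obtain i where i: "i < l" "x = col (A * B) i"
      using AB by (auto simp: cols_def)
    then have "x = A *\<^sub>v col B i" using A B by (metis col_mult2)
    moreover have "col B i \<in> carrier_vec k" using B i by auto
    ultimately show "x \<in> col_space A"
      using A by (subst col_space_eq[OF A]) auto
  qed
  then have "span (set (cols (A * B))) \<subseteq> span (set (cols A))"
    unfolding col_space_def using cA by (simp add: span_is_subset span_is_submodule)
  then have "subspace class_ring (span (set (cols (A * B)))) (span_vs (set (cols A)))"
    using nested_subspaces span_is_subspace cA cAB by blast
  moreover have "vectorspace class_ring (span_vs (set (cols A)))"
    using span_is_subspace cA subspace_is_vs by blast
  moreover have "vectorspace.fin_dim class_ring (span_vs (set (cols A)))"
    "vectorspace.fin_dim class_ring (span_vs (set (cols (A * B))))"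
    using fin_dim_span_cols A AB by blast+
  ultimately show ?thesis
    unfolding rank_def using vectorspace.subspace_dim by fastforce
qed

lemma rank_ge_if_det_mult_nonzero:
  fixes A F G :: "'a::field mat"
  assumes F: "F \<in> carrier_mat q n" and A: "A \<in> carrier_mat n k" and G: "G \<in> carrier_mat k q"
    and det: "det (F * A * G) \<noteq> 0"
  shows "q \<le> vec_space.rank n A"
proof -
  interpret vec_space "TYPE('a)" n .
  define B where "B = A * G"
  have B: "B \<in> carrier_mat n q" using A G by (simp add: B_def)
  have FB: "F * A * G = F * B" "F * B \<in> carrier_mat q q"
    using F A G B by (simp_all add: B_def)
  have inj: "v = 0\<^sub>v q" if "v \<in> carrier_vec q" "B *\<^sub>v v = 0\<^sub>v n" for v
  proof (rule ccontr)
    assume "v \<noteq> 0\<^sub>v q"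
    moreover have "(F * B) *\<^sub>v v = 0\<^sub>v q"
      using that F B by (subst assoc_mult_mat_vec[of F q n B q v]) (auto intro!: eq_vecI)
    ultimately show False
      using det that FB det_0_iff_vec_prod_zero_field[OF FB(2)] by auto
  qed
  have dist: "distinct (cols B)"
  proof (rule ccontr)
    assume "\<not> distinct (cols B)"
    then obtain i j where ij: "i < q" "j < q" "i \<noteq> j" "col B i = col B j"
      using B by (auto simp: distinct_conv_nth)
    then have "col (F * B) i = col (F * B) j"
      using ij col_mult2[OF F B] by simp
    then have "det (F * B) = 0"
      using ij det_identical_cols[OF FB(2)] by blast
    then show False using det FB by simp
  qed
  have "lin_indpt (set (cols B))"
    using lin_depE[OF B _ dist] inj by blast
  then have "rank B = q"
    using lin_indpt_full_rank[OF B dist] by simp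
  then show ?thesis
    using rank_mult_le[OF A G] by (simp add: B_def)
qed

lemma normal_rank_ge_if_det_nonzero:
  assumes F: "F \<in> carrier_mat q m" and P: "P \<in> carrier_mat m n" and G: "G \<in> carrier_mat n q"
    and det: "det (F * P * G) \<noteq> 0"
  shows "q \<le> normal_rank P"
proof -
  interpret comm_ring_hom "to_fract :: complex poly \<Rightarrow> complex poly fract"
    by unfold_locales auto
  have "det (map_mat to_fract F * map_mat to_fract P * map_mat to_fract G) = to_fract (det (F * P * G))"
  proof -
    have "F * P \<in> carrier_mat q n" using F P by simp
    from mat_hom_mult[OF this G] mat_hom_mult[OF F P] show ?thesis
      using hom_det[of "F * P * G"] by metis
  qed
  then have "q \<le> vec_space.rank m (map_mat to_fract P)"
    using rank_ge_if_det_mult_nonzero[of "map_mat to_fract F" q m "map_mat to_fract P" n "map_mat to_fract G"]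
      F P G det by simp
  then show ?thesis using P by (simp add: normal_rank_def)
qed

lemma normal_rank_mult_le:
  assumes W: "W \<in> carrier_mat m q" and X: "X \<in> carrier_mat q n"
  shows "normal_rank (W * X) \<le> q"
proof -
  interpret comm_ring_hom "to_fract :: complex poly \<Rightarrow> complex poly fract"
    by unfold_locales auto
  have "normal_rank (W * X) = vec_space.rank m (map_mat to_fract W * map_mat to_fract X)"
    using W X by (simp add: normal_rank_def mat_hom_mult[of _ m q _ n])
  also have "\<dots> \<le> vec_space.rank m (map_mat to_fract W)"
    by (rule rank_mult_le[of _ _ q _ n]) (use W X in auto)
  also have "\<dots> \<le> q"
    by (rule vec_space.rank_le_nc) (use W in auto)
  finally show ?thesis .
qed

section \<open>Weighted skew-symmetric matrices\<close>

lemma coeff_mult_sum_bounds: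
  fixes p q :: "'a::comm_ring_1 poly"
  assumes "degree p \<le> a" "degree q \<le> b"
  shows "coeff (p * q) (a + b) = coeff p a * coeff q b"
proof (cases "degree p = a \<and> degree q = b")
  case True
  then show ?thesis using coeff_mult_degree_sum by blast
next
  case False
  then have "degree p < a \<or> degree q < b" using assms by auto
  moreover have "degree (p * q) < a + b"
    using degree_mult_le[of p q] assms False by linarith
  ultimately show ?thesis by (auto simp: coeff_eq_0)
qed

lemma coeff_prod_sum_bounds:
  fixes f :: "'a \<Rightarrow> 'b::comm_ring_1 poly"
  assumes "finite I" "\<And>i. i \<in> I \<Longrightarrow> degree (f i) \<le> k i"
  shows "coeff (\<Prod>i\<in>I. f i) (\<Sum>i\<in>I. k i) = (\<Prod>i\<in>I. coeff (f i) (k i))"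
  using assms
proof (induction I rule: finite_induct)
  case (insert a I)
  have "degree (\<Prod>i\<in>I. f i) \<le> (\<Sum>i\<in>I. k i)"
    using degree_prod_sum_le[of I f] sum_mono[of I "degree \<circ> f" k] insert by fastforce
  then show ?case
    using insert by (simp add: coeff_mult_sum_bounds)
qed simp

lemma coeff_mult_eq_0I:
  assumes "\<And>i. i \<le> n \<Longrightarrow> coeff p i = 0 \<or> coeff q (n - i) = 0"
  shows "coeff (p * q) n = 0"
  unfolding coeff_mult
proof (intro sum.neutral ballI)
  fix i assume "i \<in> {..n}"
  then show "coeff p i * coeff q (n - i) = 0" using assms[of i] by auto
qed

lemma det_zero_imp_kernel_on:
  fixes A :: "nat \<Rightarrow> nat \<Rightarrow> 'a::field"
  assumes f: "bij_betw f {0..<n} S" and det: "det (mat n n (\<lambda>(i, j). A (f i) (f j))) = 0"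
  obtains c where "\<exists>i\<in>S. c i \<noteq> 0" "\<forall>i\<in>S. (\<Sum>j\<in>S. A i j * c j) = 0"
proof -
  let ?A = "mat n n (\<lambda>(i, j). A (f i) (f j))"
  have "?A \<in> carrier_mat n n" by simp
  then obtain v where v: "v \<in> carrier_vec n" "v \<noteq> 0\<^sub>v n" "?A *\<^sub>v v = 0\<^sub>v n"
    using det det_0_iff_vec_prod_zero_field by blast
  define g where "g = the_inv_into {0..<n} f"
  have gf: "g (f i) = i" if "i < n" for i
    using f that by (simp add: g_def bij_betw_def the_inv_into_f_f)
  show thesis
  proof
    obtain i where "i < n" "v $ i \<noteq> 0"
      using v(1,2) by (metis carrier_vecD eq_vecI index_zero_vec)
    then show "\<exists>i\<in>S. v $ g i \<noteq> 0"
      using f gf by (intro bexI[of _ "f i"]) (auto simp: bij_betw_def)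
    show "\<forall>i\<in>S. (\<Sum>j\<in>S. A i j * v $ g j) = 0"
    proof
      fix i assume "i \<in> S"
      then obtain k where k: "k < n" "i = f k" using f by (auto simp: bij_betw_def)
      have "(\<Sum>j\<in>S. A i j * v $ g j) = (\<Sum>j=0..<n. A i (f j) * v $ j)"
        using gf by (subst sum.reindex_bij_betw[OF f, symmetric]) (auto intro: sum.cong)
      also have "\<dots> = (?A *\<^sub>v v) $ k"
        using k v(1) by (auto simp: scalar_prod_def intro!: sum.cong)
      finally show "(\<Sum>j\<in>S. A i j * v $ g j) = 0" using v(3) k by simp
    qed
  qed
qed

text \<open>The weight \<open>e i\<close> bounds the degree of a generator that the index \<open>i\<close> stands for: if
  \<open>M\<close> is \<open>graded_skew\<close>, the bivector \<open>\<Sum> M i j b\<^sub>i \<and> b\<^sub>j\<close> with \<open>deg b\<^sub>i \<le> e i\<close> has degree at most \<open>d\<close>.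
  Since \<open>e i + e j\<close> may exceed \<open>d\<close>, degrees are bounded through vanishing coefficients.\<close>

definition graded_skew :: "nat set \<Rightarrow> nat \<Rightarrow> (nat \<Rightarrow> nat) \<Rightarrow> (nat \<Rightarrow> nat \<Rightarrow> complex poly) \<Rightarrow> bool" where
  "graded_skew S d e M \<longleftrightarrow>
    (\<forall>i\<in>S. \<forall>j\<in>S. M i j = - M j i) \<and>
    (\<forall>i\<in>S. \<forall>j\<in>S. \<forall>l. d < l + e i + e j \<longrightarrow> coeff (M i j) l = 0)"

text \<open>In the Leibniz expansion of \<open>det M\<close> every nonzero term has degree at most
  \<open>N = n d - 2 \<Sum> e\<close>, and the coefficient at \<open>N\<close> is the determinant of the matrix of leading
  coefficients. If no determinant vanishes, \<open>det M\<close> is a nonzero constant and \<open>N = 0\<close>.\<close>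

lemma pivot_or_kernel:
  fixes M :: "nat \<Rightarrow> nat \<Rightarrow> complex poly"
  assumes fin: "finite S" and ne: "S \<noteq> {}"
    and M: "graded_skew S d e M"
  obtains
    (kernel) c x where "\<exists>i\<in>S. c i \<noteq> 0" "\<forall>i\<in>S. (\<Sum>j\<in>S. poly (M i j) x * c j) = 0"
  | (kernel_at_infinity) c where "\<exists>i\<in>S. c i \<noteq> 0"
      "\<forall>i\<in>S. (\<Sum>j\<in>S. (if e i + e j \<le> d then coeff (M i j) (d - e i - e j) else 0) * c j) = 0"
  | (pivot) i j where "i \<in> S" "j \<in> S" "e i + e j = d" "M i j \<noteq> 0"
proof -
  have graded: "coeff (M i j) l = 0" if "i \<in> S" "j \<in> S" "d < l + e i + e j" for i j l
    using M that unfolding graded_skew_def by blast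
  obtain n :: nat and f where f: "bij_betw f {0..<n} S"
    using ex_bij_betw_nat_finite[OF fin] by blast
  then have n0: "n > 0"
    using ne by (cases n) (auto simp: bij_betw_def)
  have fS: "\<And>i. i < n \<Longrightarrow> f i \<in> S"
    using f by (auto simp: bij_betw_def)
  have perm: "q i < n" if "q permutes {0..<n}" "i < n" for q i
    using permutes_in_image[OF that(1), of i] that(2) by simp
  define top where "top i j = (if e i + e j \<le> d then coeff (M i j) (d - e i - e j) else 0)" for i j
  define D where "D = det (mat n n (\<lambda>(i, j). M (f i) (f j)))"
  define Dx where "Dx x = det (mat n n (\<lambda>(i, j). poly (M (f i) (f j)) x))" for x
  define Dtop where "Dtop = det (mat n n (\<lambda>(i, j). top (f i) (f j)))"
  have Dx: "poly D x = Dx x" for x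
  proof -
    interpret comm_ring_hom "\<lambda>p. poly p x" by unfold_locales auto
    have 1: "poly (det X) x = det (map_mat (\<lambda>p. poly p x) X)" for X
      by (rule hom_det[symmetric])
    have 2: "map_mat (\<lambda>p. poly p x) (mat n n (\<lambda>(i, j). M (f i) (f j)))
        = mat n n (\<lambda>(i, j). poly (M (f i) (f j)) x)"
      by (auto intro!: eq_matI)
    show ?thesis unfolding D_def Dx_def 1 2 ..
  qed
  show thesis
  proof (cases "\<exists>x. Dx x = 0")
    case True
    then obtain x where "det (mat n n (\<lambda>(i, j). poly (M (f i) (f j)) x)) = 0"
      unfolding Dx_def by blast
    from det_zero_imp_kernel_on[OF f this] obtain c where
      "\<exists>i\<in>S. c i \<noteq> 0" "\<forall>i\<in>S. (\<Sum>j\<in>S. poly (M i j) x * c j) = 0" .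
    then show thesis by (rule kernel)
  next
    case False
    then have "\<forall>x. poly D x \<noteq> 0" using Dx by simp
    then have deg0: "degree D = 0"
      using fundamental_theorem_of_algebra[of D] constant_degree[of D] by blast
    have D0: "D \<noteq> 0"
      using \<open>\<forall>x. poly D x \<noteq> 0\<close> by auto
    have Dsum: "D = (\<Sum>p | p permutes {0..<n}. signof p * (\<Prod>i=0..<n. M (f i) (f (p i))))"
      unfolding D_def by (subst det_def') (auto intro!: sum.cong prod.cong simp: perm)
    have "\<exists>p. p permutes {0..<n} \<and> (\<Prod>i=0..<n. M (f i) (f (p i))) \<noteq> 0"
    proof (rule ccontr)
      assume "\<not> ?thesis"
      then have "D = 0" unfolding Dsum by (intro sum.neutral) simp
      then show False using D0 by simp
    qed
    then obtain p where p: "p permutes {0..<n}" "(\<Prod>i=0..<n. M (f i) (f (p i))) \<noteq> 0"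
      by blast
    have nz: "M i j = 0" if "i \<in> S" "j \<in> S" "e i + e j > d" for i j
      using graded[OF that(1,2)] that(3) by (intro poly_eqI) auto
    have sumD: "(\<Sum>i=0..<n. d - e (f i) - e (f (q i))) + 2 * (\<Sum>i=0..<n. e (f i)) = n * d"
      if q: "q permutes {0..<n}" and le: "\<forall>i<n. e (f i) + e (f (q i)) \<le> d" for q
    proof -
      have "(\<Sum>i=0..<n. e (f i)) = (\<Sum>i=0..<n. e (f (q i)))"
        using sum.permute[OF q, of "\<lambda>i. e (f i)"] by (simp add: comp_def)
      then have "(\<Sum>i=0..<n. d - e (f i) - e (f (q i))) + 2 * (\<Sum>i=0..<n. e (f i))
          = (\<Sum>i=0..<n. (d - e (f i) - e (f (q i))) + e (f i) + e (f (q i)))"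
        by (simp add: sum.distrib)
      also have "\<dots> = (\<Sum>i=0..<n. d)" using le by (intro sum.cong) auto
      finally show ?thesis by simp
    qed
    have le: "e (f i) + e (f (p i)) \<le> d" if "i < n" for i
    proof (rule ccontr)
      assume "\<not> ?thesis"
      then have "M (f i) (f (p i)) = 0"
        using nz fS that perm[OF p(1)] by simp
      then show False using p(2) that by auto
    qed
    define N where "N = (\<Sum>i=0..<n. d - e (f i) - e (f (p i)))"
    show thesis
    proof (cases "N = 0")
      case True
      then have "e (f 0) + e (f (p 0)) = d" using le[OF n0] n0 by (force simp: N_def intro: antisym)
      moreover have "M (f 0) (f (p 0)) \<noteq> 0" using p(2) n0 by auto
      ultimately show thesis
        using pivot[of "f 0" "f (p 0)"] fS n0 perm[OF p(1)] by simp
    next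
      case False
      have "coeff (signof q * (\<Prod>i=0..<n. M (f i) (f (q i)))) N
          = signof q * (\<Prod>i=0..<n. top (f i) (f (q i)))"
        if q: "q permutes {0..<n}" for q
      proof (cases "\<forall>i<n. e (f i) + e (f (q i)) \<le> d")
        case True
        then have N: "N = (\<Sum>i=0..<n. d - e (f i) - e (f (q i)))"
          using sumD[OF q True] sumD[OF p(1)] le by (simp add: N_def)
        have "coeff (\<Prod>i=0..<n. M (f i) (f (q i))) N
            = (\<Prod>i=0..<n. coeff (M (f i) (f (q i))) (d - e (f i) - e (f (q i))))"
          unfolding N
        proof (rule coeff_prod_sum_bounds)
          fix i assume "i \<in> {0..<n}"
          then show "degree (M (f i) (f (q i))) \<le> d - e (f i) - e (f (q i))"
            using graded fS perm[OF q] by (intro degree_le) auto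
        qed simp
        also have "\<dots> = (\<Prod>i=0..<n. top (f i) (f (q i)))"
          using True by (intro prod.cong) (auto simp: top_def)
        finally show ?thesis by (simp add: sign_def)
      next
        case False
        then obtain i where i: "i < n" "\<not> e (f i) + e (f (q i)) \<le> d" by blast
        then have "M (f i) (f (q i)) = 0" "top (f i) (f (q i)) = 0"
          using nz fS perm[OF q] by (simp_all add: top_def)
        then have "(\<Prod>i=0..<n. M (f i) (f (q i))) = 0" "(\<Prod>i=0..<n. top (f i) (f (q i))) = 0"
          using i(1) by (auto intro!: prod_zero)
        then show ?thesis by (simp only: mult_zero_right coeff_0)
      qed
      then have "coeff D N = Dtop"
        unfolding Dsum coeff_sum Dtop_def
        by (subst det_def') (auto intro!: sum.cong prod.cong simp: perm)
      moreover have "coeff D N = 0" using False deg0 by (simp add: coeff_eq_0)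
      ultimately have "Dtop = 0" by simp
      from det_zero_imp_kernel_on[OF f this[unfolded Dtop_def]] obtain c where
        "\<exists>i\<in>S. c i \<noteq> 0" "\<forall>i\<in>S. (\<Sum>j\<in>S. top i j * c j) = 0" .
      then show thesis unfolding top_def by (rule kernel_at_infinity)
    qed
  qed
qed

definition hyp :: "nat \<Rightarrow> (nat \<Rightarrow> 'a::comm_ring_1) \<Rightarrow> (nat \<Rightarrow> 'a) \<Rightarrow> 'a" where
  "hyp s x y = (\<Sum>k<s. x (2 * k) * y (2 * k + 1) - x (2 * k + 1) * y (2 * k))"

lemma hyp_swap: "hyp s x y = - hyp s y x"
  by (simp add: hyp_def sum_negf[symmetric] algebra_simps)

lemma hyp_self: "hyp s x x = 0"
  by (simp add: hyp_def algebra_simps)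

lemma hyp_combination:
  "hyp s (\<lambda>t. p * x t - (\<Sum>i\<in>I. c i * X i t)) y = p * hyp s x y - (\<Sum>i\<in>I. c i * hyp s (X i) y)"
proof -
  have "hyp s (\<lambda>t. p * x t - (\<Sum>i\<in>I. c i * X i t)) y
      = (\<Sum>k<s. p * (x (2 * k) * y (2 * k + 1) - x (2 * k + 1) * y (2 * k))
          - (\<Sum>i\<in>I. c i * (X i (2 * k) * y (2 * k + 1) - X i (2 * k + 1) * y (2 * k))))"
    unfolding hyp_def
    by (intro sum.cong refl) (simp add: algebra_simps sum_distrib_left sum_distrib_right sum_subtractf)
  also have "\<dots> = p * hyp s x y
      - (\<Sum>k<s. \<Sum>i\<in>I. c i * (X i (2 * k) * y (2 * k + 1) - X i (2 * k + 1) * y (2 * k)))"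
    by (simp add: hyp_def sum_subtractf sum_distrib_left right_diff_distrib)
  also have "\<dots> = p * hyp s x y - (\<Sum>i\<in>I. c i * hyp s (X i) y)"
    by (subst sum.swap) (simp add: hyp_def sum_distrib_left)
  finally show ?thesis .
qed

text \<open>The columns \<open>w _ t\<close> are paired as \<open>(2 k, 2 k + 1)\<close>. The vectors \<open>z _ t\<close> are dual to them up to
  the factor \<open>h\<close>; they certify that the \<open>2 s\<close> columns are independent over the rational functions.\<close>

definition graded_factorization ::
  "nat set \<Rightarrow> nat \<Rightarrow> (nat \<Rightarrow> nat) \<Rightarrow> (nat \<Rightarrow> nat \<Rightarrow> complex poly) \<Rightarrow>
    nat \<Rightarrow> (nat \<Rightarrow> nat \<Rightarrow> complex poly) \<Rightarrow> (nat \<Rightarrow> nat) \<Rightarrow> (nat \<Rightarrow> nat \<Rightarrow> complex poly) \<Rightarrow>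
    complex poly \<Rightarrow> bool" where
  "graded_factorization S d e M s w \<alpha> z h \<longleftrightarrow>
    (\<forall>i\<in>S. \<forall>j\<in>S. M i j = hyp s (w i) (w j)) \<and>
    (\<forall>i\<in>S. \<forall>t<2 * s. \<forall>l. \<alpha> t < l + e i \<longrightarrow> coeff (w i t) l = 0) \<and>
    (\<forall>k<s. \<alpha> (2 * k) + \<alpha> (2 * k + 1) = d) \<and>
    h \<noteq> 0 \<and>
    (\<forall>t<2 * s. \<forall>t'<2 * s. (\<Sum>i\<in>S. z i t * w i t') = (if t = t' then h else 0))"

text \<open>Row \<open>k\<close> of \<open>M\<close>, modified by multiples of the other rows, is \<open>p\<close> times \<open>q\<close>. Replacing it by \<open>q\<close>
  gives a congruent matrix in which the generator \<open>k\<close> has absorbed the factor \<open>p\<close>.\<close>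

lemma raise_weight:
  assumes M: "graded_skew S d e M" and fin: "finite S" and k: "k \<in> S"
    and p: "p \<noteq> 0" "degree p \<le> 1"
    and c: "\<And>i l. i \<in> S - {k} \<Longrightarrow> e i < l + e k \<Longrightarrow> coeff (c i) l = 0"
    and q: "\<And>j. j \<in> S - {k} \<Longrightarrow> p * q j = M k j + (\<Sum>i\<in>S - {k}. c i * M i j)"
    and q_deg: "\<And>j l. j \<in> S - {k} \<Longrightarrow> d < l + Suc (e k) + e j \<Longrightarrow> coeff (q j) l = 0"
  obtains M' where "graded_skew S d (e(k := Suc (e k))) M'"
    "\<And>s w \<alpha> z h. graded_factorization S d (e(k := Suc (e k))) M' s w \<alpha> z h \<Longrightarrow>
      \<exists>w z h. graded_factorization S d e M s w \<alpha> z h"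
proof
  let ?S = "S - {k}" and ?e = "e(k := Suc (e k))"
  define M' where "M' i j = (if i = k then if j = k then 0 else q j else if j = k then - q i else M i j)"
    for i j
  have skew: "M i j = - M j i" if "i \<in> S" "j \<in> S" for i j
    using M that unfolding graded_skew_def by blast
  have diag: "M i i = 0" if "i \<in> S" for i
    using skew[OF that that] by simp
  have M_deg: "coeff (M i j) l = 0" if "i \<in> S" "j \<in> S" "d < l + e i + e j" for i j l
    using M that unfolding graded_skew_def by blast
  show "graded_skew S d ?e M'"
    unfolding graded_skew_def
  proof (intro conjI ballI allI impI)
    fix i j assume "i \<in> S" "j \<in> S"
    then show "M' i j = - M' j i" using skew[of i j] by (simp add: M'_def)
  next
    fix i j l assume "i \<in> S" "j \<in> S" "d < l + ?e i + ?e j"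
    then show "coeff (M' i j) l = 0"
      using M_deg[of i j l] q_deg[of i l] q_deg[of j l] by (auto simp: M'_def add_ac split: if_splits)
  qed
  fix s w \<alpha> z h
  assume F: "graded_factorization S d ?e M' s w \<alpha> z h"
  then have M'_hyp: "\<And>i j. i \<in> S \<Longrightarrow> j \<in> S \<Longrightarrow> M' i j = hyp s (w i) (w j)"
    and w_deg: "\<And>i t l. i \<in> S \<Longrightarrow> t < 2 * s \<Longrightarrow> \<alpha> t < l + ?e i \<Longrightarrow> coeff (w i t) l = 0"
    and \<alpha>: "\<forall>k<s. \<alpha> (2 * k) + \<alpha> (2 * k + 1) = d" and h: "h \<noteq> 0"
    and dual: "\<And>t t'. t < 2 * s \<Longrightarrow> t' < 2 * s \<Longrightarrow>
      (\<Sum>i\<in>S. z i t * w i t') = (if t = t' then h else 0)"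
    unfolding graded_factorization_def by blast+
  define w' where "w' i = (if i = k then (\<lambda>t. p * w k t - (\<Sum>i\<in>?S. c i * w i t)) else w i)" for i
  define z' where "z' i t = (if i = k then z k t else p * z i t + c i * z k t)" for i t
  have kj: "M k j = hyp s (w' k) (w' j)" if "j \<in> ?S" for j
  proof -
    have "hyp s (w' k) (w' j) = p * hyp s (w k) (w j) - (\<Sum>i\<in>?S. c i * hyp s (w i) (w j))"
      using that by (simp add: w'_def hyp_combination)
    also have "\<dots> = p * q j - (\<Sum>i\<in>?S. c i * M i j)"
      using that k by (auto simp: M'_hyp[symmetric] M'_def intro!: sum.cong)
    finally show ?thesis using q[OF that] by simp
  qed
  have "M i j = hyp s (w' i) (w' j)" if ij: "i \<in> S" "j \<in> S" for i j
  proof -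
    consider "i = k" "j = k" | "i = k" "j \<noteq> k" | "i \<noteq> k" "j = k" | "i \<noteq> k" "j \<noteq> k" by blast
    then show ?thesis
    proof cases
      case 3
      then have "M i j = - hyp s (w' j) (w' i)" using kj[of i] ij skew[of i j] by simp
      then show ?thesis using hyp_swap[of s "w' i" "w' j"] by simp
    qed (use ij diag kj M'_hyp[OF ij] in \<open>auto simp: hyp_self w'_def M'_def\<close>)
  qed
  moreover have "coeff (w' i t) l = 0" if i: "i \<in> S" and t: "t < 2 * s" and l: "\<alpha> t < l + e i" for i t l
  proof (cases "i = k")
    case True
    have "coeff (p * w k t) l = 0"
    proof (rule coeff_mult_eq_0I)
      fix b assume "b \<le> l"
      then show "coeff p b = 0 \<or> coeff (w k t) (l - b) = 0"
        using w_deg[OF k t, of "l - b"] l True p(2) by (cases "b \<le> 1") (auto simp: coeff_eq_0)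
    qed
    moreover have "coeff (c i * w i t) l = 0" if "i \<in> ?S" for i
    proof (rule coeff_mult_eq_0I)
      fix b assume "b \<le> l"
      then show "coeff (c i) b = 0 \<or> coeff (w i t) (l - b) = 0"
        using w_deg[OF _ t, of i "l - b"] c[OF that, of b] that l True by (cases "e i < b + e k") auto
    qed
    ultimately show ?thesis using True by (simp add: w'_def coeff_sum)
  qed (use w_deg[OF i t] l in \<open>auto simp: w'_def\<close>)
  moreover have "(\<Sum>i\<in>S. z' i t * w' i t') = (if t = t' then p * h else 0)"
    if t: "t < 2 * s" "t' < 2 * s" for t t'
  proof -
    have "(\<Sum>i\<in>S. z' i t * w' i t')
        = z k t * (p * w k t' - (\<Sum>i\<in>?S. c i * w i t')) + (\<Sum>i\<in>?S. (p * z i t + c i * z k t) * w i t')"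
      using k fin by (simp add: sum.remove z'_def w'_def)
    also have "\<dots> = p * (z k t * w k t' + (\<Sum>i\<in>?S. z i t * w i t'))"
      by (simp add: algebra_simps sum_distrib_left sum.distrib)
    also have "\<dots> = p * (\<Sum>i\<in>S. z i t * w i t')"
      using k fin by (simp add: sum.remove)
    finally show ?thesis using dual[OF t] by simp
  qed
  ultimately have "graded_factorization S d e M s w' \<alpha> z' (p * h)"
    using \<alpha> h p(1) by (simp add: graded_factorization_def)
  then show "\<exists>w z h. graded_factorization S d e M s w \<alpha> z h" by blast
qed

lemma drop_zero_row:
  assumes F: "graded_factorization (S - {a}) d e M s w \<alpha> z h"
    and M: "graded_skew S d e M" and fin: "finite S" and a: "a \<in> S" "d < e a"
  shows "graded_factorization S d e M s (w(a := \<lambda>_. 0)) \<alpha> z h"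
proof -
  have M_deg: "coeff (M i j) l = 0" if "i \<in> S" "j \<in> S" "d < l + e i + e j" for i j l
    using M that unfolding graded_skew_def by blast
  have "M i a = 0" "M a i = 0" if "i \<in> S" for i
    using M_deg that a by (auto intro!: poly_eqI)
  moreover have "hyp s (\<lambda>_. 0) x = 0" "hyp s x (\<lambda>_. 0) = 0" for x :: "nat \<Rightarrow> complex poly"
    by (simp_all add: hyp_def)
  ultimately show ?thesis
    using F a fin by (auto simp: graded_factorization_def sum.remove[of S a])
qed

lemma split_pivot:
  assumes M: "graded_skew S d e M" and fin: "finite S" and ij: "i\<^sub>0 \<in> S" "j\<^sub>0 \<in> S"
    and e: "e i\<^sub>0 + e j\<^sub>0 = d" and nz: "M i\<^sub>0 j\<^sub>0 \<noteq> 0"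
  obtains M' where "graded_skew (S - {i\<^sub>0, j\<^sub>0}) d e M'"
    "\<And>s w \<alpha> z h. graded_factorization (S - {i\<^sub>0, j\<^sub>0}) d e M' s w \<alpha> z h \<Longrightarrow>
      \<exists>w \<alpha> z h. graded_factorization S d e M (Suc s) w \<alpha> z h"
proof
  let ?S = "S - {i\<^sub>0, j\<^sub>0}"
  have skew: "M i j = - M j i" if "i \<in> S" "j \<in> S" for i j
    using M that unfolding graded_skew_def by blast
  have diag: "M i i = 0" if "i \<in> S" for i
    using skew[OF that that] by simp
  have M_deg: "coeff (M i j) l = 0" if "i \<in> S" "j \<in> S" "d < l + e i + e j" for i j l
    using M that unfolding graded_skew_def by blast
  have neq: "i\<^sub>0 \<noteq> j\<^sub>0" using nz diag ij by auto
  define b where "b = coeff (M i\<^sub>0 j\<^sub>0) 0"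
  have M_b: "M i\<^sub>0 j\<^sub>0 = [:b:]"
  proof (rule poly_eqI)
    fix l show "coeff (M i\<^sub>0 j\<^sub>0) l = coeff [:b:] l"
      using M_deg[OF ij, of l] e by (cases l) (auto simp: b_def)
  qed
  then have b: "b \<noteq> 0" and M_b': "M j\<^sub>0 i\<^sub>0 = [:- b:]" using nz skew[OF ij(2,1)] by auto
  define u where "u i = smult (1 / b) (M i\<^sub>0 i)" for i
  define v where "v i = M j\<^sub>0 i" for i
  have uv: "u i\<^sub>0 = 0" "u j\<^sub>0 = 1" "v i\<^sub>0 = [:- b:]" "v j\<^sub>0 = 0"
    using diag ij b by (simp_all add: u_def v_def M_b M_b' one_pCons)
  have u_deg: "coeff (u i) l = 0" if "i \<in> S" "d - e i\<^sub>0 < l + e i" for i l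
    using M_deg[OF ij(1) that(1), of l] that(2) by (simp add: u_def)
  have v_deg: "coeff (v i) l = 0" if "i \<in> S" "d - e j\<^sub>0 < l + e i" for i l
    using M_deg[OF ij(2) that(1), of l] that(2) by (simp add: v_def)
  define M' where "M' i j = M i j - (u i * v j - v i * u j)" for i j
  have "coeff (u i * v j) l = 0" if "i \<in> S" "j \<in> S" "d < l + e i + e j" for i j l
  proof (rule coeff_mult_eq_0I)
    fix a assume "a \<le> l"
    then show "coeff (u i) a = 0 \<or> coeff (v j) (l - a) = 0"
      using u_deg[OF that(1), of a] v_deg[OF that(2), of "l - a"] that(3) e
      by (cases "d - e i\<^sub>0 < a + e i") auto
  qed
  then have "coeff (M' i j) l = 0" if "i \<in> S" "j \<in> S" "d < l + e i + e j" for i j l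
    using M_deg that by (simp add: M'_def mult.commute[of "v i"] add_ac)
  moreover have "M' i j = - M' j i" if "i \<in> S" "j \<in> S" for i j
    using skew[OF that] by (simp add: M'_def)
  ultimately show "graded_skew ?S d e M'"
    unfolding graded_skew_def by blast
  fix s w \<alpha> z h
  assume "graded_factorization ?S d e M' s w \<alpha> z h"
  then have M'_hyp: "\<And>i j. i \<in> ?S \<Longrightarrow> j \<in> ?S \<Longrightarrow> M' i j = hyp s (w i) (w j)"
    and w_deg: "\<And>i t l. i \<in> ?S \<Longrightarrow> t < 2 * s \<Longrightarrow> \<alpha> t < l + e i \<Longrightarrow> coeff (w i t) l = 0"
    and \<alpha>: "\<And>k. k < s \<Longrightarrow> \<alpha> (2 * k) + \<alpha> (2 * k + 1) = d" and h: "h \<noteq> 0"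
    and dual: "\<And>t t'. t < 2 * s \<Longrightarrow> t' < 2 * s \<Longrightarrow>
      (\<Sum>i\<in>?S. z i t * w i t') = (if t = t' then h else 0)"
    unfolding graded_factorization_def by blast+
  define w' where "w' i t = (if t < 2 * s then if i \<in> ?S then w i t else 0
    else if t = 2 * s then u i else v i)" for i t
  define z' where "z' i t =
    (if t < 2 * s then
       if i = i\<^sub>0 then smult (1 / b) (\<Sum>j\<in>?S. z j t * v j)
       else if i = j\<^sub>0 then - (\<Sum>j\<in>?S. z j t * u j)
       else z i t
     else if t = 2 * s then if i = j\<^sub>0 then h else 0
     else if i = i\<^sub>0 then smult (- (1 / b)) h else 0)" for i t
  define \<alpha>' where "\<alpha>' t = (if t < 2 * s then \<alpha> t else if t = 2 * s then d - e i\<^sub>0 else d - e j\<^sub>0)" for t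
  have hyp_w': "hyp (Suc s) (w' i) (w' j) = hyp s (w' i) (w' j) + (u i * v j - v i * u j)" for i j
    by (simp add: hyp_def w'_def)
  have hyp_old: "hyp s (w' i) (w' j) = (if i \<in> ?S \<and> j \<in> ?S then M' i j else 0)" for i j
    using M'_hyp[of i j] by (auto simp: hyp_def w'_def intro!: sum.cong sum.neutral)
  have hyp_M: "M i j = hyp (Suc s) (w' i) (w' j)" if i: "i \<in> S" and j: "j \<in> S" for i j
  proof -
    have "M i j = u i * v j - v i * u j" if "i \<notin> ?S \<or> j \<notin> ?S"
    proof -
      have "i = i\<^sub>0 \<or> i = j\<^sub>0 \<or> j = i\<^sub>0 \<or> j = j\<^sub>0" using that i j by blast
      then show ?thesis
        using b skew[OF i ij(1)] skew[OF i ij(2)] by (elim disjE) (simp_all add: uv, simp_all add: u_def v_def)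
    qed
    then show ?thesis
      unfolding hyp_w' hyp_old M'_def by auto
  qed
  have sum_S: "(\<Sum>i\<in>S. f i) = f i\<^sub>0 + f j\<^sub>0 + (\<Sum>i\<in>?S. f i)" for f :: "nat \<Rightarrow> complex poly"
  proof -
    have "S = insert i\<^sub>0 (insert j\<^sub>0 ?S)" using ij by blast
    then show ?thesis using fin neq by (metis (no_types, lifting) Diff_iff add.assoc finite_Diff
      finite_insert insertE insertI1 insertI2 sum.insert)
  qed
  have w'_new: "w' i (2 * s) = u i" "w' i (Suc (2 * s)) = v i" for i
    by (simp_all add: w'_def)
  have dual': "(\<Sum>i\<in>S. z' i t * w' i t') = (if t = t' then h else 0)"
    if t: "t < 2 * Suc s" and t': "t' < 2 * Suc s" for t t'
  proof -
    consider "t < 2 * s" | "t = 2 * s" | "t = Suc (2 * s)" using t by (auto simp: less_Suc_eq)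
    then show ?thesis
    proof cases
      case 1
      consider "t' < 2 * s" | "t' = 2 * s" | "t' = Suc (2 * s)" using t' by (auto simp: less_Suc_eq)
      then show ?thesis
      proof cases
        case a: 1
        have "(\<Sum>i\<in>S. z' i t * w' i t') = (\<Sum>i\<in>?S. z i t * w i t')"
          unfolding sum_S using 1 a by (simp add: w'_def z'_def)
        then show ?thesis using dual[OF 1 a] by simp
      next
        case a: 2
        have "(\<Sum>i\<in>?S. z' i t * w' i t') = (\<Sum>i\<in>?S. z i t * u i)"
          using 1 a by (intro sum.cong) (auto simp: w'_new z'_def)
        then show ?thesis
          unfolding sum_S using 1 a neq by (simp add: w'_new uv z'_def)
      next
        case a: 3
        have "(\<Sum>i\<in>?S. z' i t * w' i t') = (\<Sum>i\<in>?S. z i t * v i)"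
          using 1 a by (intro sum.cong) (auto simp: w'_new z'_def)
        then show ?thesis
          unfolding sum_S using 1 a neq b by (simp add: w'_new uv z'_def)
      qed
    next
      case 2
      have "(\<Sum>i\<in>?S. z' i t * w' i t') = 0"
        using 2 by (intro sum.neutral) (auto simp: z'_def)
      then show ?thesis
        unfolding sum_S using 2 t' neq by (auto simp: z'_def w'_def uv)
    next
      case 3
      have "(\<Sum>i\<in>?S. z' i t * w' i t') = 0"
        using 3 by (intro sum.neutral) (auto simp: z'_def)
      then show ?thesis
        unfolding sum_S using 3 t' neq b by (auto simp: z'_def w'_def uv)
    qed
  qed
  have "coeff (w' i t) l = 0" if "i \<in> S" "t < 2 * Suc s" "\<alpha>' t < l + e i" for i t l
    using that u_deg v_deg w_deg by (auto simp: w'_def \<alpha>'_def split: if_splits)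
  moreover have "\<alpha>' (2 * k) + \<alpha>' (2 * k + 1) = d" if "k < Suc s" for k
    using that \<alpha>[of k] e by (auto simp: \<alpha>'_def less_Suc_eq)
  ultimately have "graded_factorization S d e M (Suc s) w' \<alpha>' z' h"
    using hyp_M dual' h by (simp add: graded_factorization_def)
  then show "\<exists>w \<alpha> z h. graded_factorization S d e M (Suc s) w \<alpha> z h" by blast
qed

lemma graded_factorization_exists:
  assumes "finite S" "graded_skew S d e M"
  shows "\<exists>s w \<alpha> z h. graded_factorization S d e M s w \<alpha> z h"
  using assms
proof (induction "\<Sum>a\<in>S. 1 + (d + 1 - e a)" arbitrary: S e M rule: less_induct)
  case less
  note fin = less.prems(1) and M = less.prems(2)
  have skew: "M i j = - M j i" if "i \<in> S" "j \<in> S" for i j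
    using M that unfolding graded_skew_def by blast
  have M_deg: "coeff (M i j) l = 0" if "i \<in> S" "j \<in> S" "d < l + e i + e j" for i j l
    using M that unfolding graded_skew_def by blast
  have smaller: "(\<Sum>a\<in>T. 1 + (d + 1 - e a)) < (\<Sum>a\<in>S. 1 + (d + 1 - e a))" if T: "T \<subset> S" for T
  proof -
    obtain b where "b \<in> S - T" using T by blast
    then show ?thesis using T fin by (intro sum_strict_mono2[of S T b]) auto
  qed
  show ?case
  proof (cases "S = {}")
    case True
    then have "graded_factorization S d e M 0 w \<alpha> z 1" for w \<alpha> z
      by (simp add: graded_factorization_def)
    then show ?thesis by blast
  next
    case ne: False
    show ?thesis
    proof (cases "\<exists>a\<in>S. d < e a")
      case True
      then obtain a where a: "a \<in> S" "d < e a" by blast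
      have "graded_skew (S - {a}) d e M"
        using M unfolding graded_skew_def by blast
      then obtain s w \<alpha> z h where "graded_factorization (S - {a}) d e M s w \<alpha> z h"
        using less.hyps[OF smaller, of "S - {a}" M] fin a by blast
      from drop_zero_row[OF this M fin a] show ?thesis by blast
    next
      case False
      then have e_le: "e a \<le> d" if "a \<in> S" for a using that by force
      have raise: ?thesis
        if k: "k \<in> S" and p: "p \<noteq> 0" "degree p \<le> 1"
          and c: "\<And>i l. i \<in> S - {k} \<Longrightarrow> e i < l + e k \<Longrightarrow> coeff (c i) l = 0"
          and q: "\<And>j. j \<in> S - {k} \<Longrightarrow> p * q j = M k j + (\<Sum>i\<in>S - {k}. c i * M i j)"
          and q_deg: "\<And>j l. j \<in> S - {k} \<Longrightarrow> d < l + Suc (e k) + e j \<Longrightarrow> coeff (q j) l = 0"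
        for k p c q
      proof -
        obtain M' where M': "graded_skew S d (e(k := Suc (e k))) M'"
          and lift: "\<And>s w \<alpha> z h. graded_factorization S d (e(k := Suc (e k))) M' s w \<alpha> z h \<Longrightarrow>
            \<exists>w z h. graded_factorization S d e M s w \<alpha> z h"
          using raise_weight[OF M fin k p c q q_deg] by blast
        have "(\<Sum>a\<in>S. 1 + (d + 1 - (e(k := Suc (e k))) a)) < (\<Sum>a\<in>S. 1 + (d + 1 - e a))"
          using k fin e_le[OF k] by (intro sum_strict_mono_ex1) auto
        from less.hyps[OF this fin M'] lift show ?thesis by blast
      qed
      have least: "\<exists>k\<in>S. c k \<noteq> 0 \<and> (\<forall>i\<in>S. c i \<noteq> 0 \<longrightarrow> e k \<le> e i)"
        if "\<exists>i\<in>S. c i \<noteq> 0" for c :: "nat \<Rightarrow> complex"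
        using that ex_min_if_finite[of "e ` {i \<in> S. c i \<noteq> 0}"] fin by fastforce
      show ?thesis
      proof (cases rule: pivot_or_kernel[OF fin ne M, case_names kernel kernel_at_infinity pivot])
        case (kernel c x)
        obtain k where k: "k \<in> S" "c k \<noteq> 0" and k_min: "\<And>i. i \<in> S \<Longrightarrow> c i \<noteq> 0 \<Longrightarrow> e k \<le> e i"
          using least[OF kernel(1)] by blast
        define c' where "c' i = [:c i / c k:]" for i
        define N where "N j = M k j + (\<Sum>i\<in>S - {k}. c' i * M i j)" for j
        have "\<exists>q. [:- x, 1:] * q = N j" if j: "j \<in> S" for j
        proof -
          have "poly (N j) x = (\<Sum>i\<in>S. poly (c' i) x * poly (M i j) x)"
            using k fin by (simp add: N_def poly_sum sum.remove[of S k] c'_def)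
          also have "\<dots> = - (1 / c k) * (\<Sum>i\<in>S. poly (M j i) x * c i)"
            unfolding sum_distrib_left using skew[OF _ j] by (intro sum.cong) (auto simp: c'_def)
          finally have "poly (N j) x = 0" using kernel(2) j by simp
          then show ?thesis by (simp add: poly_eq_0_iff_dvd dvd_def) metis
        qed
        then obtain q where q: "[:- x, 1:] * q j = N j" if "j \<in> S" for j by metis
        have c'_deg: "coeff (c' i) l = 0" if "i \<in> S - {k}" "e i < l + e k" for i l
          using k_min[of i] that by (cases l) (auto simp: c'_def)
        have N_deg: "coeff (N j) l = 0" if j: "j \<in> S" and l: "d < l + e k + e j" for j l
        proof -
          have "coeff (c' i * M i j) l = 0" if "i \<in> S - {k}" for i
            using M_deg[of i j l] k_min[of i] that j l by (cases "c i = 0") (auto simp: c'_def)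
          then show ?thesis using M_deg[of k j l] k j l by (simp add: N_def coeff_sum)
        qed
        have q_deg: "coeff (q j) l = 0" if j: "j \<in> S - {k}" and l: "d < l + Suc (e k) + e j" for j l
        proof (rule ccontr)
          assume nz: "coeff (q j) l \<noteq> 0"
          then have "q j \<noteq> 0" by auto
          then have "degree ([:- x, 1:] * q j) = Suc (degree (q j))"
            by (subst degree_mult_eq) auto
          then have "degree (N j) = Suc (degree (q j))" "N j \<noteq> 0"
            using q[of j] j by auto
          moreover have "l \<le> degree (q j)" using nz by (rule le_degree)
          ultimately have "d < degree (N j) + e k + e j" using l by simp
          then show False using N_deg[of j "degree (N j)"] j \<open>N j \<noteq> 0\<close> by simp
        qed
        show ?thesis
          by (rule raise[of k "[:- x, 1:]" c' q]) (use k c'_deg q q_deg in \<open>auto simp: N_def\<close>)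
      next
        case (kernel_at_infinity c)
        obtain k where k: "k \<in> S" "c k \<noteq> 0" and k_min: "\<And>i. i \<in> S \<Longrightarrow> c i \<noteq> 0 \<Longrightarrow> e k \<le> e i"
          using least[OF kernel_at_infinity(1)] by blast
        define c' where "c' i = monom (c i / c k) (e i - e k)" for i
        define N where "N j = M k j + (\<Sum>i\<in>S - {k}. c' i * M i j)" for j
        have c'_deg: "coeff (c' i) l = 0" if "i \<in> S - {k}" "e i < l + e k" for i l
          using k_min[of i] that by (cases "c i = 0") (auto simp: c'_def)
        have N_deg: "coeff (N j) l = 0" if j: "j \<in> S" and l: "d < l + Suc (e k) + e j" for j l
        proof -
          have N: "coeff (N j) l = (\<Sum>i\<in>S. coeff (c' i * M i j) l)"
            using k fin by (simp add: N_def coeff_sum sum.remove[of S k] c'_def coeff_monom_mult)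
          show ?thesis
          proof (cases "d < l + e k + e j")
            case True
            have "coeff (c' i * M i j) l = 0" if "i \<in> S" for i
              using M_deg[OF that j, of "l - (e i - e k)"] k_min[OF that] True
              by (cases "c i = 0") (auto simp: c'_def coeff_monom_mult)
            then show ?thesis using N by simp
          next
            case False
            then have l_eq: "l + e k + e j = d" using l by simp
            have "coeff (c' i * M i j) l = - (1 / c k) *
                ((if e j + e i \<le> d then coeff (M j i) (d - e j - e i) else 0) * c i)" if "i \<in> S" for i
            proof (cases "c i = 0")
              case nz: False
              have "l - (e i - e k) = d - e j - e i" "l < e i - e k \<longleftrightarrow> \<not> e j + e i \<le> d"
                using k_min[OF that nz] l_eq by linarith+
              then show ?thesis
                using skew[OF that j] by (simp add: c'_def coeff_monom_mult)
            qed (simp add: c'_def)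
            then have "coeff (N j) l = - (1 / c k) *
                (\<Sum>i\<in>S. (if e j + e i \<le> d then coeff (M j i) (d - e j - e i) else 0) * c i)"
              unfolding N sum_distrib_left by (intro sum.cong refl)
            then show ?thesis using kernel_at_infinity(2) j by simp
          qed
        qed
        show ?thesis
          by (rule raise[of k 1 c' N]) (use k c'_deg N_deg in \<open>auto simp: N_def\<close>)
      next
        case (pivot i j)
        obtain M' where M': "graded_skew (S - {i, j}) d e M'"
          and lift: "\<And>s w \<alpha> z h. graded_factorization (S - {i, j}) d e M' s w \<alpha> z h \<Longrightarrow>
            \<exists>w \<alpha> z h. graded_factorization S d e M (Suc s) w \<alpha> z h"
          using split_pivot[OF M fin pivot] by blast
        have "S - {i, j} \<subset> S" using pivot(1) by blast
        from less.hyps[OF smaller[OF this] _ M'] lift fin show ?thesis by blast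
      qed
    qed
  qed
qed

lemma sum_pairs: "(\<Sum>t<2 * s. f t) = (\<Sum>k<s. f (2 * k) + f (2 * k + 1))"
  for f :: "nat \<Rightarrow> 'a::comm_monoid_add"
  by (induction s) (simp_all add: add_ac)

definition pair_swap :: "nat \<Rightarrow> nat" where
  "pair_swap t = (if even t then t + 1 else t - 1)"

definition pair_sign :: "nat \<Rightarrow> 'a::comm_ring_1" where
  "pair_sign t = (if even t then 1 else - 1)"

lemma pair_sign_mult_self [simp]: "pair_sign t * pair_sign t = 1"
  by (simp add: pair_sign_def)

lemma pair_swap_less_iff [simp]: "pair_swap t < 2 * s \<longleftrightarrow> t < 2 * s"
  by (auto simp: pair_swap_def elim!: evenE oddE)

lemma pair_swap_swap [simp]: "pair_swap (pair_swap t) = t"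
  by (auto simp: pair_swap_def elim!: oddE)

lemma pair_swap_eq_iff [simp]: "pair_swap a = pair_swap b \<longleftrightarrow> a = b"
  by (metis pair_swap_swap)

lemma hyp_eq_sum: "hyp s x y = (\<Sum>t<2 * s. pair_sign t * x t * y (pair_swap t))"
  by (simp add: sum_pairs hyp_def pair_sign_def pair_swap_def)

lemma normal_rank_hyp_le:
  assumes P: "P \<in> carrier_mat m m"
    and hyp: "\<And>i j. i < m \<Longrightarrow> j < m \<Longrightarrow> P $$ (i, j) = hyp s (w i) (w j)"
  shows "normal_rank P \<le> 2 * s"
proof -
  let ?W = "mat m (2 * s) (\<lambda>(i, t). w i t)"
  let ?X = "mat (2 * s) m (\<lambda>(t, j). pair_sign t * w j (pair_swap t))"
  have "P = ?W * ?X"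
    using P hyp
    by (intro eq_matI)
       (auto simp: hyp_eq_sum scalar_prod_def lessThan_atLeast0 mult_ac intro!: sum.cong)
  then show ?thesis using normal_rank_mult_le[of ?W m "2 * s" ?X m] by simp
qed

lemma graded_factorization_det_nonzero:
  assumes F: "graded_factorization {..<m} d e M s w \<alpha> z h" and q: "q \<le> s"
  shows "det (mat (2 * q) m (\<lambda>(a, i). z i a) * mat m m (\<lambda>(i, j). M i j) *
    mat m (2 * q) (\<lambda>(j, b). pair_sign b * z j (pair_swap b))) \<noteq> 0" (is "det (?F * ?P * ?G) \<noteq> 0")
proof -
  have M: "M i j = hyp s (w i) (w j)" if "i < m" "j < m" for i j
    using F that by (simp add: graded_factorization_def)
  have dual: "(\<Sum>i<m. z i t * w i t') = (if t = t' then h else 0)" if "t < 2 * s" "t' < 2 * s" for t t'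
    using F that by (simp add: graded_factorization_def)
  have zM: "(\<Sum>i<m. z i a * M i j) = pair_sign a * h * w j (pair_swap a)"
    if a: "a < 2 * s" and j: "j < m" for a j
  proof -
    have "(\<Sum>i<m. z i a * M i j)
        = (\<Sum>i<m. \<Sum>t<2 * s. pair_sign t * w j (pair_swap t) * (z i a * w i t))"
      using j by (intro sum.cong) (simp_all add: M hyp_eq_sum sum_distrib_left mult_ac)
    also have "\<dots> = (\<Sum>t<2 * s. pair_sign t * w j (pair_swap t) * (\<Sum>i<m. z i a * w i t))"
      by (subst sum.swap) (simp add: sum_distrib_left)
    also have "\<dots> = (\<Sum>t<2 * s. if a = t then pair_sign t * w j (pair_swap t) * h else 0)"
      using dual[OF a] by (intro sum.cong) auto
    also have "\<dots> = pair_sign a * h * w j (pair_swap a)"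
      using a by (simp add: mult_ac)
    finally show ?thesis .
  qed
  have "?F * ?P * ?G = h ^ 2 \<cdot>\<^sub>m 1\<^sub>m (2 * q)"
  proof (rule eq_matI)
    fix a b assume "a < dim_row (h ^ 2 \<cdot>\<^sub>m 1\<^sub>m (2 * q))" "b < dim_col (h ^ 2 \<cdot>\<^sub>m 1\<^sub>m (2 * q))"
    then have ab: "a < 2 * q" "b < 2 * q" "a < 2 * s" "b < 2 * s" using q by auto
    have FP: "(?F * ?P) $$ (a, j) = pair_sign a * h * w j (pair_swap a)" if "j < m" for j
      using zM[OF ab(3) that] ab that by (simp add: scalar_prod_def lessThan_atLeast0)
    have "(?F * ?P * ?G) $$ (a, b) = (\<Sum>j<m. (?F * ?P) $$ (a, j) * ?G $$ (j, b))"
      using ab by (simp add: scalar_prod_def lessThan_atLeast0)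
    also have "\<dots> = (\<Sum>j<m. pair_sign a * pair_sign b * h * (z j (pair_swap b) * w j (pair_swap a)))"
      using ab by (intro sum.cong refl, subst FP) (auto simp: mult_ac)
    also have "\<dots> = pair_sign a * pair_sign b * h * (\<Sum>j<m. z j (pair_swap b) * w j (pair_swap a))"
      by (simp add: sum_distrib_left)
    also have "\<dots> = (h ^ 2 \<cdot>\<^sub>m 1\<^sub>m (2 * q)) $$ (a, b)"
      using ab dual[of "pair_swap b" "pair_swap a"] by (auto simp: power2_eq_square)
    finally show "(?F * ?P * ?G) $$ (a, b) = (h ^ 2 \<cdot>\<^sub>m 1\<^sub>m (2 * q)) $$ (a, b)" .
  qed auto
  then show ?thesis
    using F by (simp add: graded_factorization_def)
qed

section \<open>Closedness of the rank bound\<close>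

lemma POL_grade_iff:
  "P \<in> POL_grade d p q \<longleftrightarrow>
    P \<in> carrier_mat p q \<and> (\<forall>i<p. \<forall>j<q. \<forall>l>d. coeff (P $$ (i, j)) l = 0)"
proof (cases "P \<in> carrier_mat p q")
  case True
  then have "mat_coeff P l = 0\<^sub>m p q \<longleftrightarrow> (\<forall>i<p. \<forall>j<q. coeff (P $$ (i, j)) l = 0)" for l
    by (auto simp: mat_coeff_def mat_eq_iff)
  then show ?thesis using True by (auto simp: POL_grade_def POL_def)
qed (simp add: POL_grade_def POL_def)

lemma POL_ss_iff:
  "P \<in> POL_ss d m \<longleftrightarrow>
    P \<in> POL_grade d m m \<and> (\<forall>i<m. \<forall>j<m. P $$ (i, j) = - P $$ (j, i))"
proof (cases "P \<in> POL_grade d m m")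
  case True
  then have P: "P \<in> carrier_mat m m"
    and deg: "\<And>i j l. i < m \<Longrightarrow> j < m \<Longrightarrow> d < l \<Longrightarrow> coeff (P $$ (i, j)) l = 0"
    by (auto simp: POL_grade_iff)
  have "transpose_mat (mat_coeff P l) = - mat_coeff P l \<longleftrightarrow>
      (\<forall>i<m. \<forall>j<m. coeff (P $$ (j, i)) l = - coeff (P $$ (i, j)) l)" for l
    using P by (auto simp: mat_coeff_def mat_eq_iff)
  moreover have "(\<forall>l\<le>d. \<forall>i<m. \<forall>j<m. coeff (P $$ (j, i)) l = - coeff (P $$ (i, j)) l) \<longleftrightarrow>
      (\<forall>i<m. \<forall>j<m. P $$ (i, j) = - P $$ (j, i))" (is "?L \<longleftrightarrow> ?R")
  proof
    assume L: ?L
    show ?R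
    proof (intro allI impI poly_eqI)
      fix i j l assume ij: "i < m" "j < m"
      show "coeff (P $$ (i, j)) l = coeff (- P $$ (j, i)) l"
      proof (cases "l \<le> d")
        case True
        then have "coeff (P $$ (i, j)) l = - coeff (P $$ (j, i)) l" using L ij by blast
        then show ?thesis by simp
      qed (use deg ij in simp)
    qed
  next
    assume R: ?R
    show ?L
    proof (intro allI impI)
      fix l i j assume "i < m" "j < m"
      then have "P $$ (j, i) = - P $$ (i, j)" using R by blast
      then show "coeff (P $$ (j, i)) l = - coeff (P $$ (i, j)) l" by simp
    qed
  qed
  ultimately show ?thesis using True by (simp add: POL_ss_def)
qed (simp add: POL_ss_def)

lemma POL_ssD:
  assumes "P \<in> POL_ss d m"
  shows POL_ss_carrier: "P \<in> carrier_mat m m"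
    and POL_ss_coeff: "\<And>i j l. i < m \<Longrightarrow> j < m \<Longrightarrow> d < l \<Longrightarrow> coeff (P $$ (i, j)) l = 0"
    and POL_ss_skew: "\<And>i j. i < m \<Longrightarrow> j < m \<Longrightarrow> P $$ (i, j) = - P $$ (j, i)"
  using assms unfolding POL_ss_iff POL_grade_iff by blast+

lemma pol_closure_iff:
  "P \<in> pol_closure d m S \<longleftrightarrow>
    P \<in> POL_ss d m \<and> (\<forall>\<epsilon>>0. \<exists>Q\<in>S. Q \<in> POL_ss d m \<and> pol_dist d m P Q < \<epsilon>)"
proof -
  interpret Metric_space "POL_ss d m" "pol_dist d m" by (rule Metric_space_POL_ss)
  show ?thesis
    unfolding pol_closure_def metric_closure_of by auto
qed

lemma tendsto_mat_mult:
  fixes A B :: "nat \<Rightarrow> complex mat"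
  assumes dims: "\<And>n. A n \<in> carrier_mat p q" "\<And>n. B n \<in> carrier_mat q r"
      "A' \<in> carrier_mat p q" "B' \<in> carrier_mat q r"
    and lim: "\<And>i j. i < p \<Longrightarrow> j < q \<Longrightarrow> (\<lambda>n. A n $$ (i, j)) \<longlonglongrightarrow> A' $$ (i, j)"
      "\<And>i j. i < q \<Longrightarrow> j < r \<Longrightarrow> (\<lambda>n. B n $$ (i, j)) \<longlonglongrightarrow> B' $$ (i, j)"
    and ij: "i < p" "j < r"
  shows "(\<lambda>n. (A n * B n) $$ (i, j)) \<longlonglongrightarrow> (A' * B') $$ (i, j)"
proof -
  have entry: "(X * Y) $$ (i, j) = (\<Sum>k<q. X $$ (i, k) * Y $$ (k, j))"
    if "X \<in> carrier_mat p q" "Y \<in> carrier_mat q r" for X Y :: "complex mat"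
    using that ij by (auto simp: scalar_prod_def lessThan_atLeast0 intro!: sum.cong)
  show ?thesis
    unfolding entry[OF dims(1,2)] entry[OF dims(3,4)]
    using lim ij by (auto intro!: tendsto_sum tendsto_mult)
qed

lemma tendsto_det:
  fixes A :: "nat \<Rightarrow> complex mat"
  assumes "\<And>n. A n \<in> carrier_mat q q" "A' \<in> carrier_mat q q"
    and "\<And>i j. i < q \<Longrightarrow> j < q \<Longrightarrow> (\<lambda>n. A n $$ (i, j)) \<longlonglongrightarrow> A' $$ (i, j)"
  shows "(\<lambda>n. det (A n)) \<longlonglongrightarrow> det A'"
proof -
  have "p i < q" if "p permutes {0..<q}" "i < q" for p i
    using permutes_in_image[OF that(1), of i] that(2) by simp
  then show ?thesis
    unfolding det_def'[OF assms(1)] det_def'[OF assms(2)]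
    using assms(3) by (auto intro!: tendsto_sum tendsto_mult tendsto_prod)
qed

lemma det_zero_in_pol_closure:
  assumes P: "P \<in> pol_closure d m S" and F: "F \<in> carrier_mat q m" and G: "G \<in> carrier_mat m q"
    and S: "\<And>Q. Q \<in> S \<Longrightarrow> det (F * Q * G) = 0"
  shows "det (F * P * G) = 0"
proof -
  have "\<forall>n. \<exists>Q. Q \<in> S \<and> Q \<in> POL_ss d m \<and> pol_dist d m P Q < 1 / real (Suc n)"
  proof
    fix n
    have "0 < 1 / real (Suc n)" by simp
    then show "\<exists>Q. Q \<in> S \<and> Q \<in> POL_ss d m \<and> pol_dist d m P Q < 1 / real (Suc n)"
      using P unfolding pol_closure_iff by blast
  qed
  from choice[OF this] obtain Q where Q: "\<And>n. Q n \<in> S" "\<And>n. Q n \<in> POL_ss d m"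
    "\<And>n. pol_dist d m P (Q n) < 1 / real (Suc n)" by blast
  have P_ss: "P \<in> POL_ss d m" using P by (simp add: pol_closure_iff)
  have dims: "P \<in> carrier_mat m m" "Q n \<in> carrier_mat m m" for n
    using P_ss Q(2) POL_ss_carrier by blast+
  have lim: "(\<lambda>n. coeff (Q n $$ (i, j)) l) \<longlonglongrightarrow> coeff (P $$ (i, j)) l"
    if ij: "i < m" "j < m" for i j l
  proof (cases "l \<le> d")
    case True
    have "cmod (coeff (P $$ (i, j)) l - coeff (Q n $$ (i, j)) l) \<le> pol_dist d m P (Q n)" for n
      using member_le_L2_set[of "{..d} \<times> {..<m} \<times> {..<m}" "(l, i, j)"
        "\<lambda>(l, j, k). cmod (mat_coeff P l $$ (j, k) - mat_coeff (Q n) l $$ (j, k))"]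
        True ij dims dims(2)[of n] by (simp add: pol_dist_L2_set mat_coeff_def)
    then have le: "cmod (coeff (Q n $$ (i, j)) l - coeff (P $$ (i, j)) l) \<le> 1 / real (Suc n)" for n
      using Q(3)[of n] by (metis less_eq_real_def norm_minus_commute order_trans)
    have "(\<lambda>n. 1 / real (Suc n)) \<longlonglongrightarrow> 0"
      by (rule LIMSEQ_Suc[OF lim_1_over_n])
    then have "(\<lambda>n. coeff (Q n $$ (i, j)) l - coeff (P $$ (i, j)) l) \<longlonglongrightarrow> 0"
      by (rule Lim_null_comparison[OF always_eventually[OF allI[OF le]]])
    then show ?thesis by (simp add: LIM_zero_iff)
  next
    case False
    then show ?thesis
      using POL_ss_coeff[OF P_ss ij] POL_ss_coeff[OF Q(2) ij] by simp
  qed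
  have "poly (det (F * P * G)) x = 0" for x
  proof -
    interpret comm_ring_hom "\<lambda>p. poly p x" by unfold_locales auto
    let ?e = "map_mat (\<lambda>p. poly p x)"
    have eval: "poly (det (F * X * G)) x = det (?e F * ?e X * ?e G)" if "X \<in> carrier_mat m m" for X
    proof -
      have "F * X \<in> carrier_mat q m" using F that by simp
      from mat_hom_mult[OF this G] mat_hom_mult[OF F that] show ?thesis
        using hom_det[of "F * X * G"] by metis
    qed
    have poly_sum: "poly (X $$ (i, j)) x = (\<Sum>l\<le>d. coeff (X $$ (i, j)) l * x ^ l)"
      if "X \<in> POL_ss d m" "i < m" "j < m" for X i j
    proof -
      have "degree (X $$ (i, j)) \<le> d"
        using POL_ss_coeff[OF that] by (intro degree_le) simp
      then show ?thesis
        unfolding poly_altdef by (intro sum.mono_neutral_left) (auto simp: coeff_eq_0)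
    qed
    have "(\<lambda>n. det (?e F * ?e (Q n) * ?e G)) \<longlonglongrightarrow> det (?e F * ?e P * ?e G)"
    proof (intro tendsto_det tendsto_mat_mult)
      fix i j assume ij: "i < m" "j < m"
      have "(\<lambda>n. poly (Q n $$ (i, j)) x) \<longlonglongrightarrow> poly (P $$ (i, j)) x"
        using lim ij poly_sum[OF P_ss ij] poly_sum[OF Q(2) ij]
        by (auto intro!: tendsto_sum tendsto_mult)
      moreover have "?e (Q n) $$ (i, j) = poly (Q n $$ (i, j)) x" for n
        using dims(2)[of n] ij by simp
      ultimately show "(\<lambda>n. ?e (Q n) $$ (i, j)) \<longlonglongrightarrow> ?e P $$ (i, j)"
        using dims(1) ij by simp
    qed (use F G dims in auto)
    moreover have "det (?e F * ?e (Q n) * ?e G) = 0" for n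
      using eval[OF dims(2)] S[OF Q(1)] by simp
    ultimately show ?thesis
      using eval[OF dims(1)] by (simp add: LIMSEQ_const_iff)
  qed
  then show ?thesis using poly_all_0_iff_0 by blast
qed

lemma graded_factorization_POL_ss:
  assumes P: "P \<in> POL_ss d m"
  obtains s w \<alpha> z h where "graded_factorization {..<m} d (\<lambda>_. 0) (\<lambda>i j. P $$ (i, j)) s w \<alpha> z h"
proof -
  have "graded_skew {..<m} d (\<lambda>_. 0) (\<lambda>i j. P $$ (i, j))"
    unfolding graded_skew_def
  proof (intro conjI ballI allI impI)
    fix i j assume "i \<in> {..<m}" "j \<in> {..<m}"
    then show "P $$ (i, j) = - P $$ (j, i)" using POL_ss_skew[OF P, of i j] by blast
  qed (simp add: POL_ss_coeff[OF P])
  then show thesis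
    using graded_factorization_exists[of "{..<m}"] that by blast
qed

lemma POL_ss_rank_closed: "pol_closure d m (POL_ss_rank d (2 * r) m) \<subseteq> POL_ss_rank d (2 * r) m"
proof
  fix P assume P: "P \<in> pol_closure d m (POL_ss_rank d (2 * r) m)"
  then have P_ss: "P \<in> POL_ss d m" by (simp add: pol_closure_iff)
  then have dim: "P \<in> carrier_mat m m" by (rule POL_ss_carrier)
  have P_mat: "mat m m (\<lambda>(i, j). P $$ (i, j)) = P" using dim by auto
  obtain s w \<alpha> z h where fact: "graded_factorization {..<m} d (\<lambda>_. 0) (\<lambda>i j. P $$ (i, j)) s w \<alpha> z h"
    using graded_factorization_POL_ss[OF P_ss] .
  show "P \<in> POL_ss_rank d (2 * r) m"
  proof (cases "s \<le> r")
    case True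
    have "normal_rank P \<le> 2 * s"
      using fact by (intro normal_rank_hyp_le[OF dim, of s w]) (simp add: graded_factorization_def)
    then show ?thesis using P_ss True by (simp add: POL_ss_rank_def)
  next
    case False
    let ?F = "mat (2 * Suc r) m (\<lambda>(a, i). z i a)"
    let ?G = "mat m (2 * Suc r) (\<lambda>(j, b). pair_sign b * z j (pair_swap b))"
    have "det (?F * Q * ?G) = 0" if "Q \<in> POL_ss_rank d (2 * r) m" for Q
    proof (rule ccontr)
      assume "det (?F * Q * ?G) \<noteq> 0"
      moreover have "Q \<in> carrier_mat m m"
        using that unfolding POL_ss_rank_def by (blast intro: POL_ss_carrier)
      ultimately have "2 * Suc r \<le> normal_rank Q"
        by (intro normal_rank_ge_if_det_nonzero[of ?F _ m Q m ?G]) auto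
      then show False using that by (simp add: POL_ss_rank_def)
    qed
    then have "det (?F * P * ?G) = 0"
      by (intro det_zero_in_pol_closure[OF P]) auto
    moreover have "det (?F * P * ?G) \<noteq> 0"
      using graded_factorization_det_nonzero[OF fact, of "Suc r"] False P_mat by simp
    ultimately show ?thesis by blast
  qed
qed

section \<open>Sums of bivectors\<close>

definition wedge :: "nat \<Rightarrow> (nat \<Rightarrow> nat \<Rightarrow> 'a::comm_ring_1) \<Rightarrow> (nat \<Rightarrow> nat \<Rightarrow> 'a) \<Rightarrow> nat \<Rightarrow> nat \<Rightarrow> 'a" where
  "wedge r u v i j = (\<Sum>k<r. u k i * v k j - v k i * u k j)"

definition deg_le_on :: "nat \<Rightarrow> (nat \<Rightarrow> 'a::zero poly) \<Rightarrow> nat \<Rightarrow> bool" where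
  "deg_le_on m x c \<longleftrightarrow> (\<forall>i<m. \<forall>l>c. coeff (x i) l = 0)"

definition deg_eq_on :: "nat \<Rightarrow> (nat \<Rightarrow> 'a::zero poly) \<Rightarrow> nat \<Rightarrow> bool" where
  "deg_eq_on m x c \<longleftrightarrow> deg_le_on m x c \<and> (\<exists>i<m. coeff (x i) c \<noteq> 0)"

lemma nat_half: "nat \<lfloor>real d / 2\<rfloor> = d div 2" "nat \<lceil>real d / 2\<rceil> = (d + 1) div 2"
proof -
  show "nat \<lfloor>real d / 2\<rfloor> = d div 2"
    using floor_divide_of_nat_eq[of d 2, where ?'a = real] by simp
  show "nat \<lceil>real d / 2\<rceil> = (d + 1) div 2"
  proof (cases "even d")
    case False
    then obtain k where "d = 2 * k + 1" by (elim oddE)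
    moreover have "\<lceil>real (2 * k + 1) / 2\<rceil> = int k + 1" by (rule ceiling_unique) auto
    ultimately show ?thesis by simp
  qed (auto elim!: evenE)
qed

lemma G_ss_iff:
  "Q \<in> G_ss d r m \<longleftrightarrow> Q \<in> carrier_mat m m \<and>
    (\<exists>u v. (\<forall>k<r. deg_le_on m (u k) (d div 2)) \<and> (\<forall>k<r. deg_le_on m (v k) ((d + 1) div 2)) \<and>
      (\<forall>i<m. \<forall>j<m. Q $$ (i, j) = wedge r u v i j))" (is "_ \<longleftrightarrow> ?R")
proof
  assume "Q \<in> G_ss d r m"
  then obtain U V where UV: "U \<in> POL_grade (d div 2) m r" "V \<in> POL_grade ((d + 1) div 2) m r"
    and Q: "Q = U * transpose_mat V - V * transpose_mat U"
    by (auto simp: G_ss_def nat_half)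
  then have dims: "U \<in> carrier_mat m r" "V \<in> carrier_mat m r" by (auto simp: POL_grade_iff)
  show ?R
  proof (intro conjI exI allI impI)
    show "Q \<in> carrier_mat m m" unfolding Q using dims by (auto intro!: carrier_matI)
    show "deg_le_on m (\<lambda>i. U $$ (i, k)) (d div 2)" "deg_le_on m (\<lambda>i. V $$ (i, k)) ((d + 1) div 2)"
      if "k < r" for k
      using UV that by (auto simp: POL_grade_iff deg_le_on_def)
    show "Q $$ (i, j) = wedge r (\<lambda>k i. U $$ (i, k)) (\<lambda>k i. V $$ (i, k)) i j" if "i < m" "j < m" for i j
      using Q dims that by (simp add: wedge_def scalar_prod_def lessThan_atLeast0 sum_subtractf)
  qed
next
  assume ?R
  then obtain u v where Q: "Q \<in> carrier_mat m m"
    and u: "\<And>k. k < r \<Longrightarrow> deg_le_on m (u k) (d div 2)"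
    and v: "\<And>k. k < r \<Longrightarrow> deg_le_on m (v k) ((d + 1) div 2)"
    and Q_eq: "\<And>i j. i < m \<Longrightarrow> j < m \<Longrightarrow> Q $$ (i, j) = wedge r u v i j" by blast
  let ?U = "mat m r (\<lambda>(i, k). u k i)" and ?V = "mat m r (\<lambda>(i, k). v k i)"
  have "Q = ?U * transpose_mat ?V - ?V * transpose_mat ?U"
    using Q Q_eq by (intro eq_matI)
      (auto simp: wedge_def scalar_prod_def lessThan_atLeast0 sum_subtractf)
  moreover have "?U \<in> POL_grade (d div 2) m r" "?V \<in> POL_grade ((d + 1) div 2) m r"
    using u v by (auto simp: POL_grade_iff deg_le_on_def)
  ultimately show "Q \<in> G_ss d r m" unfolding G_ss_def nat_half by blast
qed

lemma vec_degree_is_col_iff: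
  assumes "L \<in> carrier_mat m n" "k < n"
  shows "vec_degree_is (col L k) c \<longleftrightarrow> deg_eq_on m (\<lambda>i. L $$ (i, k)) c"
  using assms by (auto simp: vec_degree_is_def deg_eq_on_def deg_le_on_def vec_eq_iff)

lemma mult_antidiag_block_mult_transpose:
  fixes L :: "complex poly mat"
  assumes L: "L \<in> carrier_mat m (2 * r)" and ij: "i < m" "j < m"
  defines "J \<equiv> four_block_mat (0\<^sub>m r r) (antidiag_mat r) (- antidiag_mat r) (0\<^sub>m r r)"
  shows "(L * J * transpose_mat L) $$ (i, j) =
    wedge r (\<lambda>k i. L $$ (i, k)) (\<lambda>k i. L $$ (i, 2 * r - 1 - k)) i j"
proof -
  have J_dim: "J \<in> carrier_mat (2 * r) (2 * r)"
    by (simp add: J_def antidiag_mat_def mult_2 carrier_matI)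
  have J: "J $$ (t, t') = (if t' = 2 * r - 1 - t then if t < r then 1 else - 1 else 0)"
    if "t < 2 * r" "t' < 2 * r" for t t'
    using that by (auto simp: J_def antidiag_mat_def)
  have "(X * transpose_mat L) $$ (i, j) = (\<Sum>t'<2 * r. X $$ (i, t') * L $$ (j, t'))"
    if "X \<in> carrier_mat m (2 * r)" for X
    using that L ij by (simp add: scalar_prod_def lessThan_atLeast0)
  from this[OF mult_carrier_mat[OF L J_dim]]
  have "(L * J * transpose_mat L) $$ (i, j) = (\<Sum>t'<2 * r. (L * J) $$ (i, t') * L $$ (j, t'))" .
  also have "\<dots> = (\<Sum>t'<2 * r. \<Sum>t<2 * r. L $$ (i, t) * J $$ (t, t') * L $$ (j, t'))"
    using L J_dim ij by (intro sum.cong refl) (simp add: scalar_prod_def lessThan_atLeast0 sum_distrib_right)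
  also have "\<dots> = (\<Sum>t<2 * r. \<Sum>t'<2 * r. L $$ (i, t) * J $$ (t, t') * L $$ (j, t'))"
    by (rule sum.swap)
  also have "\<dots> = (\<Sum>t<2 * r. \<Sum>t'<2 * r. if t' = 2 * r - 1 - t
      then (if t < r then 1 else - 1) * (L $$ (i, t) * L $$ (j, t')) else 0)"
    by (intro sum.cong refl) (simp add: J)
  also have "\<dots> = (\<Sum>t<2 * r. (if t < r then 1 else - 1) * (L $$ (i, t) * L $$ (j, 2 * r - 1 - t)))"
    by (intro sum.cong refl) auto
  also have "\<dots> = (\<Sum>t<r. L $$ (i, t) * L $$ (j, 2 * r - 1 - t))
      + (\<Sum>t\<in>{r..<2 * r}. - (L $$ (i, t) * L $$ (j, 2 * r - 1 - t)))"
  proof -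
    have split: "{..<2 * r} = {..<r} \<union> {r..<2 * r}" by auto
    show ?thesis
      unfolding split by (subst sum.union_disjoint) (auto intro!: arg_cong2[of _ _ _ _ "(+)"] sum.cong)
  qed
  also have "(\<Sum>t\<in>{r..<2 * r}. - (L $$ (i, t) * L $$ (j, 2 * r - 1 - t)))
      = (\<Sum>t<r. - (L $$ (i, 2 * r - 1 - t) * L $$ (j, t)))"
    by (rule sum.reindex_bij_witness[of _ "\<lambda>t. 2 * r - 1 - t" "\<lambda>t. 2 * r - 1 - t"]) auto
  finally show ?thesis by (simp add: wedge_def sum_subtractf sum_negf)
qed

lemma A_ss_replicate_iff:
  "Q \<in> A_ss d m (replicate r c) \<longleftrightarrow> Q \<in> carrier_mat m m \<and>
    (\<exists>x y. (\<forall>k<r. deg_eq_on m (x k) c) \<and> (\<forall>k<r. deg_eq_on m (y k) (d - c)) \<and>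
      (\<forall>i<m. \<forall>j<m. Q $$ (i, j) = wedge r x y i j))" (is "_ \<longleftrightarrow> ?R")
proof
  let ?J = "four_block_mat (0\<^sub>m r r) (antidiag_mat r) (- antidiag_mat r) (0\<^sub>m r r)"
  have J: "?J \<in> carrier_mat (2 * r) (2 * r)"
    by (simp add: antidiag_mat_def mult_2 carrier_matI)
  {
    assume "Q \<in> A_ss d m (replicate r c)"
    then obtain L where L: "L \<in> carrier_mat m (2 * r)" and Q: "Q = L * ?J * transpose_mat L"
      and deg: "\<And>k. k < r \<Longrightarrow> vec_degree_is (col L k) c"
        "\<And>k. k < r \<Longrightarrow> vec_degree_is (col L (2 * r - 1 - k)) (d - c)"
      by (auto simp: A_ss_def Let_def POL_def)
    show ?R
    proof (intro conjI exI allI impI)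
      show "Q \<in> carrier_mat m m"
        unfolding Q by (rule mult_carrier_mat[OF mult_carrier_mat[OF L J]]) (use L in simp)
      show "deg_eq_on m (\<lambda>i. L $$ (i, k)) c" "deg_eq_on m (\<lambda>i. L $$ (i, 2 * r - 1 - k)) (d - c)"
        if "k < r" for k
        using deg[OF that] that vec_degree_is_col_iff[OF L, of k] vec_degree_is_col_iff[OF L, of "2 * r - 1 - k"]
        by auto
      show "Q $$ (i, j) = wedge r (\<lambda>k i. L $$ (i, k)) (\<lambda>k i. L $$ (i, 2 * r - 1 - k)) i j"
        if "i < m" "j < m" for i j
        unfolding Q using mult_antidiag_block_mult_transpose[OF L that] .
    qed
  }
  assume ?R
  then obtain x y where Q: "Q \<in> carrier_mat m m"
    and x: "\<And>k. k < r \<Longrightarrow> deg_eq_on m (x k) c"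
    and y: "\<And>k. k < r \<Longrightarrow> deg_eq_on m (y k) (d - c)"
    and Q_eq: "\<And>i j. i < m \<Longrightarrow> j < m \<Longrightarrow> Q $$ (i, j) = wedge r x y i j" by blast
  define L where "L = mat m (2 * r) (\<lambda>(i, t). if t < r then x t i else y (2 * r - 1 - t) i)"
  have L: "L \<in> carrier_mat m (2 * r)" by (simp add: L_def)
  have entry: "L $$ (i, k) = x k i" "L $$ (i, 2 * r - 1 - k) = y k i" if "i < m" "k < r" for i k
    using that by (auto simp: L_def)
  have "Q = L * ?J * transpose_mat L"
  proof (rule eq_matI)
    fix i j assume "i < dim_row (L * ?J * transpose_mat L)" "j < dim_col (L * ?J * transpose_mat L)"
    then have ij: "i < m" "j < m" using L by auto
    have "wedge r (\<lambda>k i. L $$ (i, k)) (\<lambda>k i. L $$ (i, 2 * r - 1 - k)) i j = wedge r x y i j"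
      unfolding wedge_def using entry ij by (intro sum.cong) auto
    then show "Q $$ (i, j) = (L * ?J * transpose_mat L) $$ (i, j)"
      using mult_antidiag_block_mult_transpose[OF L ij] Q_eq[OF ij] by simp
  qed (use Q L in auto)
  moreover have "vec_degree_is (col L k) c" "vec_degree_is (col L (2 * r - 1 - k)) (d - c)" if "k < r" for k
    using x[OF that] y[OF that] that entry[OF _ that]
    by (auto simp: vec_degree_is_col_iff[OF L] deg_eq_on_def deg_le_on_def)
  ultimately show "Q \<in> A_ss d m (replicate r c)"
    using L by (auto simp: A_ss_def Let_def POL_def)
qed

lemma A_ss_subset_G_ss: "A_ss d m (replicate r ((d + 1) div 2)) \<subseteq> G_ss d r m"
proof
  fix Q assume "Q \<in> A_ss d m (replicate r ((d + 1) div 2))"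
  then obtain x y where Q: "Q \<in> carrier_mat m m"
    and x: "\<And>k. k < r \<Longrightarrow> deg_eq_on m (x k) ((d + 1) div 2)"
    and y: "\<And>k. k < r \<Longrightarrow> deg_eq_on m (y k) (d - (d + 1) div 2)"
    and Q_eq: "\<And>i j. i < m \<Longrightarrow> j < m \<Longrightarrow> Q $$ (i, j) = wedge r x y i j"
    unfolding A_ss_replicate_iff by blast
  have "d - (d + 1) div 2 = d div 2" by presburger
  then have "\<forall>k<r. deg_le_on m (\<lambda>i. - y k i) (d div 2)"
    using y by (simp add: deg_eq_on_def deg_le_on_def)
  moreover have "\<forall>k<r. deg_le_on m (x k) ((d + 1) div 2)"
    using x by (simp add: deg_eq_on_def)
  moreover have "wedge r x y i j = wedge r (\<lambda>k i. - y k i) x i j" for i j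
    unfolding wedge_def by (intro sum.cong) (auto simp: algebra_simps)
  ultimately show "Q \<in> G_ss d r m"
    unfolding G_ss_iff using Q Q_eq by metis
qed

lemma G_ss_subset_POL_ss_rank: "G_ss d r m \<subseteq> POL_ss_rank d (2 * r) m"
proof
  fix Q assume "Q \<in> G_ss d r m"
  then obtain u v where Q: "Q \<in> carrier_mat m m"
    and u: "\<And>k. k < r \<Longrightarrow> deg_le_on m (u k) (d div 2)"
    and v: "\<And>k. k < r \<Longrightarrow> deg_le_on m (v k) ((d + 1) div 2)"
    and Q_eq: "\<And>i j. i < m \<Longrightarrow> j < m \<Longrightarrow> Q $$ (i, j) = wedge r u v i j"
    unfolding G_ss_iff by blast
  have mult: "coeff (u k i * v k j) l = 0" if "k < r" "i < m" "j < m" "d < l" for k i j l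
  proof (rule coeff_mult_eq_0I)
    fix b assume "b \<le> l"
    then have "d div 2 < b \<or> (d + 1) div 2 < l - b" using that(4) by presburger
    then show "coeff (u k i) b = 0 \<or> coeff (v k j) (l - b) = 0"
      using u[OF that(1)] v[OF that(1)] that(2,3) by (auto simp: deg_le_on_def)
  qed
  have "coeff (Q $$ (i, j)) l = 0" if "i < m" "j < m" "d < l" for i j l
    using that mult by (simp add: Q_eq wedge_def coeff_sum mult.commute[of "v _ i"])
  moreover have "Q $$ (i, j) = - Q $$ (j, i)" if "i < m" "j < m" for i j
    using that by (simp add: Q_eq wedge_def sum_negf[symmetric] mult.commute)
  ultimately have "Q \<in> POL_ss d m"
    unfolding POL_ss_iff POL_grade_iff using Q by blast
  moreover have "normal_rank Q \<le> 2 * r"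
  proof (rule normal_rank_hyp_le[OF Q])
    fix i j assume "i < m" "j < m"
    then show "Q $$ (i, j) = hyp r ((\<lambda>i t. if even t then u (t div 2) i else v (t div 2) i) i)
        ((\<lambda>i t. if even t then u (t div 2) i else v (t div 2) i) j)"
      by (simp add: Q_eq wedge_def hyp_def)
  qed
  ultimately show "Q \<in> POL_ss_rank d (2 * r) m" by (simp add: POL_ss_rank_def)
qed

lemma G_ss_subset_POL_ss: "G_ss d r m \<subseteq> POL_ss d m"
  using G_ss_subset_POL_ss_rank unfolding POL_ss_rank_def by blast

lemma G_ssI:
  assumes "Q \<in> carrier_mat m m"
    and "\<And>k. k < r \<Longrightarrow> deg_le_on m (u k) (d div 2)"
    and "\<And>k. k < r \<Longrightarrow> deg_le_on m (v k) ((d + 1) div 2)"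
    and "\<And>i j. i < m \<Longrightarrow> j < m \<Longrightarrow> Q $$ (i, j) = wedge r u v i j"
  shows "Q \<in> G_ss d r m"
  unfolding G_ss_iff using assms by blast

lemma A_ss_replicateI:
  assumes "Q \<in> carrier_mat m m"
    and "\<And>k. k < r \<Longrightarrow> deg_eq_on m (x k) c"
    and "\<And>k. k < r \<Longrightarrow> deg_eq_on m (y k) (d - c)"
    and "\<And>i j. i < m \<Longrightarrow> j < m \<Longrightarrow> Q $$ (i, j) = wedge r x y i j"
  shows "Q \<in> A_ss d m (replicate r c)"
  unfolding A_ss_replicate_iff using assms by blast

lemma wedge_add_smult:
  fixes u v :: "nat \<Rightarrow> nat \<Rightarrow> complex poly"
  shows "wedge r (\<lambda>k i. u k i + smult c (a k i)) (\<lambda>k i. v k i + smult c (b k i)) i j =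
    wedge r u v i j + smult c (wedge r u b i j + wedge r a v i j) + smult (c ^ 2) (wedge r a b i j)"
proof -
  have smult_sum: "smult e (\<Sum>k<r. f k) = (\<Sum>k<r. smult e (f k))" for e and f :: "nat \<Rightarrow> complex poly"
    by (induction r) (simp_all add: smult_add_right)
  show ?thesis
    unfolding wedge_def smult_sum smult_add_right sum.distrib[symmetric]
    by (intro sum.cong refl) (simp add: algebra_simps smult_add_right smult_diff_right power2_eq_square)
qed

lemma in_pol_closure_if_perturbation:
  assumes P: "P \<in> POL_ss d m"
    and Q: "\<And>\<epsilon>. 0 < \<epsilon> \<Longrightarrow> Q \<epsilon> \<in> S \<and> Q \<epsilon> \<in> POL_ss d m"
    and Q_eq: "\<And>\<epsilon> i j. 0 < \<epsilon> \<Longrightarrow> i < m \<Longrightarrow> j < m \<Longrightarrow> Q \<epsilon> $$ (i, j) =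
      P $$ (i, j) + smult (complex_of_real \<epsilon>) (A i j) + smult (complex_of_real \<epsilon> ^ 2) (B i j)"
  shows "P \<in> pol_closure d m S"
  unfolding pol_closure_iff
proof (intro conjI allI impI)
  fix \<delta> :: real assume \<delta>: "0 < \<delta>"
  let ?I = "{..d} \<times> {..<m} \<times> {..<m}"
  define C where "C = (\<Sum>(l, i, j)\<in>?I. cmod (coeff (A i j) l) + cmod (coeff (B i j) l))"
  have C: "C \<ge> 0" unfolding C_def by (intro sum_nonneg) auto
  define \<epsilon> where "\<epsilon> = min 1 (\<delta> / (C + 1))"
  have \<epsilon>: "0 < \<epsilon>" "\<epsilon> \<le> 1" using \<delta> C by (auto simp: \<epsilon>_def)
  have dims: "P \<in> carrier_mat m m" "Q \<epsilon> \<in> carrier_mat m m"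
    using P Q[OF \<epsilon>(1)] POL_ss_carrier by blast+
  have "pol_dist d m P (Q \<epsilon>)
      \<le> (\<Sum>(l, i, j)\<in>?I. cmod (mat_coeff P l $$ (i, j) - mat_coeff (Q \<epsilon>) l $$ (i, j)))"
    unfolding pol_dist_L2_set by (rule L2_set_le_sum) auto
  also have "\<dots> \<le> (\<Sum>(l, i, j)\<in>?I. \<epsilon> * (cmod (coeff (A i j) l) + cmod (coeff (B i j) l)))"
  proof (intro sum_mono, clarify)
    fix l i j assume "i < m" "j < m"
    then have "mat_coeff P l $$ (i, j) - mat_coeff (Q \<epsilon>) l $$ (i, j) =
        - (complex_of_real \<epsilon> * coeff (A i j) l + complex_of_real \<epsilon> ^ 2 * coeff (B i j) l)"
      using Q_eq[OF \<epsilon>(1)] dims by (simp add: mat_coeff_def)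
    also have "cmod \<dots> \<le> \<epsilon> * cmod (coeff (A i j) l) + \<epsilon> ^ 2 * cmod (coeff (B i j) l)"
      unfolding norm_minus_cancel
      by (rule norm_triangle_le) (use \<epsilon> in \<open>simp add: norm_mult norm_power\<close>)
    also have "\<dots> \<le> \<epsilon> * cmod (coeff (A i j) l) + \<epsilon> * cmod (coeff (B i j) l)"
      using \<epsilon> by (intro add_left_mono mult_right_mono) (auto simp: power2_eq_square mult_left_le)
    finally show "cmod (mat_coeff P l $$ (i, j) - mat_coeff (Q \<epsilon>) l $$ (i, j)) \<le>
        \<epsilon> * (cmod (coeff (A i j) l) + cmod (coeff (B i j) l))"
      by (simp add: distrib_left)
  qed
  also have "\<dots> = \<epsilon> * C"
    unfolding C_def sum_distrib_left by (intro sum.cong) auto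
  also have "\<dots> \<le> \<delta> / (C + 1) * C"
    using C by (intro mult_right_mono) (auto simp: \<epsilon>_def)
  also have "\<dots> < \<delta>" using \<delta> C by (simp add: field_simps)
  finally show "\<exists>Q\<in>S. Q \<in> POL_ss d m \<and> pol_dist d m P Q < \<delta>"
    using Q[OF \<epsilon>(1)] by blast
qed (rule P)

lemma perturb_to_exact_degree:
  fixes x :: "nat \<Rightarrow> 'a::field poly"
  assumes "deg_le_on m x c" "0 < m"
  shows "\<exists>a. \<forall>\<epsilon>. \<epsilon> \<noteq> 0 \<longrightarrow> deg_eq_on m (\<lambda>i. x i + smult \<epsilon> (a i)) c"
proof (cases "\<exists>i<m. coeff (x i) c \<noteq> 0")
  case True
  then show ?thesis using assms(1) by (intro exI[of _ "\<lambda>_. 0"]) (simp add: deg_eq_on_def)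
next
  case False
  show ?thesis
  proof (intro exI[of _ "\<lambda>_. monom 1 c"] allI impI)
    fix \<epsilon> :: 'a assume "\<epsilon> \<noteq> 0"
    then show "deg_eq_on m (\<lambda>i. x i + smult \<epsilon> (monom 1 c)) c"
      using assms False by (auto simp: deg_eq_on_def deg_le_on_def intro!: exI[of _ 0])
  qed
qed

lemma G_ss_subset_closure_A_ss:
  assumes "0 < m"
  shows "G_ss d r m \<subseteq> pol_closure d m (A_ss d m (replicate r ((d + 1) div 2)))"
proof
  fix P assume P_G: "P \<in> G_ss d r m"
  then have P_ss: "P \<in> POL_ss d m"
    using G_ss_subset_POL_ss by blast
  obtain u v where u: "\<And>k. k < r \<Longrightarrow> deg_le_on m (u k) (d div 2)"
    and v: "\<And>k. k < r \<Longrightarrow> deg_le_on m (v k) ((d + 1) div 2)"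
    and P_eq: "\<And>i j. i < m \<Longrightarrow> j < m \<Longrightarrow> P $$ (i, j) = wedge r u v i j"
    using P_G unfolding G_ss_iff by blast
  define n where "n k i = - u k i" for k i
  have n: "deg_le_on m (n k) (d div 2)" if "k < r" for k
    using u[OF that] by (simp add: deg_le_on_def n_def)
  have "\<forall>k. \<exists>a. k < r \<longrightarrow> (\<forall>\<epsilon>. \<epsilon> \<noteq> 0 \<longrightarrow> deg_eq_on m (\<lambda>i. v k i + smult \<epsilon> (a i)) ((d + 1) div 2))"
    using perturb_to_exact_degree[OF v assms] by blast
  then obtain a where a: "\<And>k \<epsilon>. k < r \<Longrightarrow> \<epsilon> \<noteq> 0 \<Longrightarrow>
      deg_eq_on m (\<lambda>i. v k i + smult \<epsilon> (a k i)) ((d + 1) div 2)" by metis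
  have "\<forall>k. \<exists>b. k < r \<longrightarrow> (\<forall>\<epsilon>. \<epsilon> \<noteq> 0 \<longrightarrow> deg_eq_on m (\<lambda>i. n k i + smult \<epsilon> (b i)) (d div 2))"
    using perturb_to_exact_degree[OF n assms] by blast
  then obtain b where b: "\<And>k \<epsilon>. k < r \<Longrightarrow> \<epsilon> \<noteq> 0 \<Longrightarrow>
      deg_eq_on m (\<lambda>i. n k i + smult \<epsilon> (b k i)) (d div 2)" by metis
  define Q where "Q \<epsilon> = mat m m (\<lambda>(i, j). wedge r (\<lambda>k i. v k i + smult (complex_of_real \<epsilon>) (a k i))
      (\<lambda>k i. n k i + smult (complex_of_real \<epsilon>) (b k i)) i j)" for \<epsilon>
  have half: "d - (d + 1) div 2 = d div 2" by presburger
  have wedge_neg: "wedge r v n i j = wedge r u v i j" for i j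
    unfolding wedge_def by (intro sum.cong) (auto simp: n_def algebra_simps)
  show "P \<in> pol_closure d m (A_ss d m (replicate r ((d + 1) div 2)))"
  proof (rule in_pol_closure_if_perturbation[OF P_ss])
    fix \<epsilon> :: real assume "0 < \<epsilon>"
    then have "Q \<epsilon> \<in> A_ss d m (replicate r ((d + 1) div 2))"
      by (intro A_ss_replicateI[of _ m r "\<lambda>k i. v k i + smult (complex_of_real \<epsilon>) (a k i)" _
            "\<lambda>k i. n k i + smult (complex_of_real \<epsilon>) (b k i)"])
         (use a b in \<open>simp_all only: half Q_def, auto\<close>)
    then show "Q \<epsilon> \<in> A_ss d m (replicate r ((d + 1) div 2)) \<and> Q \<epsilon> \<in> POL_ss d m"
      using A_ss_subset_G_ss G_ss_subset_POL_ss by blast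
  next
    fix \<epsilon> :: real and i j assume "i < m" "j < m"
    then show "Q \<epsilon> $$ (i, j) = P $$ (i, j)
        + smult (complex_of_real \<epsilon>) (wedge r v b i j + wedge r a n i j)
        + smult (complex_of_real \<epsilon> ^ 2) (wedge r a b i j)"
      unfolding Q_def by (simp add: wedge_add_smult wedge_neg P_eq)
  qed
qed

lemma poly_shift_cutoff: "monom 1 n * poly_shift n p + poly_cutoff n p = p"
  for p :: "'a::comm_ring_1 poly"
  by (rule poly_eqI) (auto simp: coeff_monom_mult coeff_poly_shift coeff_poly_cutoff)

lemma balance_degrees_aux:
  fixes p q :: "nat \<Rightarrow> complex poly"
  assumes p: "deg_le_on m p a" and q: "deg_le_on m q b" and ab: "a + b = d" "(d + 1) div 2 \<le> a"
  shows "\<exists>x y. \<forall>\<epsilon>. \<epsilon> \<noteq> 0 \<longrightarrow> (\<exists>u v. deg_le_on m u (d div 2) \<and> deg_le_on m v ((d + 1) div 2) \<and>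
    (\<forall>i j. u i * v j - v i * u j = p i * q j - q i * p j + smult \<epsilon> (x i * y j - y i * x j)))"
proof -
  define k where "k = a - (d + 1) div 2"
  define x where "x i = poly_shift k (p i)" for i
  define y where "y i = poly_cutoff k (p i)" for i
  have p_eq: "p i = monom 1 k * x i + y i" for i
    by (simp add: x_def y_def poly_shift_cutoff)
  have arith: "k + b = d div 2" "a - k = (d + 1) div 2" "k \<le> a"
  proof -
    have "d div 2 + (d + 1) div 2 = d" by presburger
    then show "k + b = d div 2" "a - k = (d + 1) div 2" "k \<le> a"
      using ab unfolding k_def by linarith+
  qed
  show ?thesis
  proof (rule exI[of _ x], rule exI[of _ y], intro allI impI)
    fix \<epsilon> :: complex assume \<epsilon>: "\<epsilon> \<noteq> 0"
    define u where "u i = - (monom 1 k * q i + smult \<epsilon> (y i))" for i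
    define v where "v i = x i - smult (1 / \<epsilon>) (q i)" for i
    have "deg_le_on m u (d div 2)"
      using q arith ab by (auto simp: deg_le_on_def u_def y_def coeff_monom_mult coeff_poly_cutoff)
    moreover have "deg_le_on m v ((d + 1) div 2)"
      using p q arith ab by (auto simp: deg_le_on_def v_def x_def coeff_poly_shift)
    moreover have "u i * v j - v i * u j = p i * q j - q i * p j + smult \<epsilon> (x i * y j - y i * x j)" for i j
    proof -
      have "smult \<epsilon> (smult (1 / \<epsilon>) z) = z" for z :: "complex poly" using \<epsilon> by simp
      then show ?thesis
        unfolding p_eq u_def v_def using \<epsilon>
        by (simp add: algebra_simps smult_diff_right smult_add_right)
    qed
    ultimately show "\<exists>u v. deg_le_on m u (d div 2) \<and> deg_le_on m v ((d + 1) div 2) \<and>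
        (\<forall>i j. u i * v j - v i * u j = p i * q j - q i * p j + smult \<epsilon> (x i * y j - y i * x j))"
      by blast
  qed
qed

lemma balance_degrees:
  fixes p q :: "nat \<Rightarrow> complex poly"
  assumes p: "deg_le_on m p a" and q: "deg_le_on m q b" and ab: "a + b = d"
  shows "\<exists>x y. \<forall>\<epsilon>. \<epsilon> \<noteq> 0 \<longrightarrow> (\<exists>u v. deg_le_on m u (d div 2) \<and> deg_le_on m v ((d + 1) div 2) \<and>
    (\<forall>i j. u i * v j - v i * u j = p i * q j - q i * p j + smult \<epsilon> (x i * y j - y i * x j)))"
proof (cases "(d + 1) div 2 \<le> a")
  case True
  then show ?thesis by (rule balance_degrees_aux[OF p q ab])
next
  case False
  then have "b + a = d" "(d + 1) div 2 \<le> b" using ab by presburger+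
  from balance_degrees_aux[OF q p this] obtain x y where
    xy: "\<And>\<epsilon>. \<epsilon> \<noteq> 0 \<Longrightarrow> \<exists>u v. deg_le_on m u (d div 2) \<and> deg_le_on m v ((d + 1) div 2) \<and>
      (\<forall>i j. u i * v j - v i * u j = q i * p j - p i * q j + smult \<epsilon> (x i * y j - y i * x j))"
    by blast
  show ?thesis
  proof (rule exI[of _ y], rule exI[of _ x], intro allI impI)
    fix \<epsilon> :: complex assume "\<epsilon> \<noteq> 0"
    then obtain u v where u: "deg_le_on m u (d div 2)" and v: "deg_le_on m v ((d + 1) div 2)"
      and uv: "\<And>i j. u i * v j - v i * u j = q i * p j - p i * q j + smult \<epsilon> (x i * y j - y i * x j)"
      using xy by blast
    have "(- u i) * v j - v i * (- u j) = p i * q j - q i * p j + smult \<epsilon> (y i * x j - x i * y j)" for i j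
    proof -
      have "(- u i) * v j - v i * (- u j) = - (u i * v j - v i * u j)" by simp
      also have "\<dots> = p i * q j - q i * p j + smult \<epsilon> (y i * x j - x i * y j)"
        unfolding uv by (simp add: smult_diff_right)
      finally show ?thesis .
    qed
    moreover have "deg_le_on m (\<lambda>i. - u i) (d div 2)" using u by (simp add: deg_le_on_def)
    ultimately show "\<exists>u v. deg_le_on m u (d div 2) \<and> deg_le_on m v ((d + 1) div 2) \<and>
        (\<forall>i j. u i * v j - v i * u j = p i * q j - q i * p j + smult \<epsilon> (y i * x j - x i * y j))"
      using v by blast
  qed
qed

lemma POL_ss_rank_subset_closure_G_ss: "POL_ss_rank d (2 * r) m \<subseteq> pol_closure d m (G_ss d r m)"
proof
  fix P assume P: "P \<in> POL_ss_rank d (2 * r) m"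
  then have P_ss: "P \<in> POL_ss d m" and rank: "normal_rank P \<le> 2 * r"
    by (auto simp: POL_ss_rank_def)
  then have dim: "P \<in> carrier_mat m m" by (blast intro: POL_ss_carrier)
  have P_mat: "mat m m (\<lambda>(i, j). P $$ (i, j)) = P" using dim by auto
  obtain s w \<alpha> z h where fact: "graded_factorization {..<m} d (\<lambda>_. 0) (\<lambda>i j. P $$ (i, j)) s w \<alpha> z h"
    using graded_factorization_POL_ss[OF P_ss] .
  have "2 * s \<le> normal_rank P"
    using graded_factorization_det_nonzero[OF fact order.refl] dim unfolding P_mat
    by (intro normal_rank_ge_if_det_nonzero) auto
  then have s: "s \<le> r" using rank by simp
  have P_eq: "P $$ (i, j) = wedge s (\<lambda>k i. w i (2 * k)) (\<lambda>k i. w i (2 * k + 1)) i j" if "i < m" "j < m" for i j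
    using fact that by (simp add: graded_factorization_def hyp_def wedge_def)
  have deg: "deg_le_on m (\<lambda>i. w i t) (\<alpha> t)" if "t < 2 * s" for t
    using fact that by (simp add: graded_factorization_def deg_le_on_def)
  have "\<forall>k. \<exists>x y. k < s \<longrightarrow> (\<forall>\<epsilon>. \<epsilon> \<noteq> 0 \<longrightarrow>
      (\<exists>u v. deg_le_on m u (d div 2) \<and> deg_le_on m v ((d + 1) div 2) \<and>
        (\<forall>i j. u i * v j - v i * u j = w i (2 * k) * w j (2 * k + 1) - w i (2 * k + 1) * w j (2 * k)
          + smult \<epsilon> (x i * y j - y i * x j))))"
  proof
    fix k
    show "\<exists>x y. k < s \<longrightarrow> (\<forall>\<epsilon>. \<epsilon> \<noteq> 0 \<longrightarrow>
      (\<exists>u v. deg_le_on m u (d div 2) \<and> deg_le_on m v ((d + 1) div 2) \<and>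
        (\<forall>i j. u i * v j - v i * u j = w i (2 * k) * w j (2 * k + 1) - w i (2 * k + 1) * w j (2 * k)
          + smult \<epsilon> (x i * y j - y i * x j))))"
    proof (cases "k < s")
      case True
      then have "2 * k < 2 * s" "2 * k + 1 < 2 * s" "\<alpha> (2 * k) + \<alpha> (2 * k + 1) = d"
        using fact by (auto simp: graded_factorization_def)
      from balance_degrees[OF deg[OF this(1)] deg[OF this(2)] this(3)] show ?thesis by simp
    qed simp
  qed
  then obtain x y where xy: "\<And>k \<epsilon>. k < s \<Longrightarrow> \<epsilon> \<noteq> 0 \<Longrightarrow>
      \<exists>u v. deg_le_on m u (d div 2) \<and> deg_le_on m v ((d + 1) div 2) \<and>
        (\<forall>i j. u i * v j - v i * u j = w i (2 * k) * w j (2 * k + 1) - w i (2 * k + 1) * w j (2 * k)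
          + smult \<epsilon> (x k i * y k j - y k i * x k j))"
    by metis
  define Q where "Q \<epsilon> = mat m m (\<lambda>(i, j). P $$ (i, j) + smult (complex_of_real \<epsilon>) (wedge s x y i j))" for \<epsilon>
  have Q_G: "Q \<epsilon> \<in> G_ss d r m" if "0 < \<epsilon>" for \<epsilon>
  proof -
    let ?c = "complex_of_real \<epsilon>"
    have "\<forall>k. \<exists>u v. k < s \<longrightarrow> deg_le_on m u (d div 2) \<and> deg_le_on m v ((d + 1) div 2) \<and>
        (\<forall>i j. u i * v j - v i * u j = w i (2 * k) * w j (2 * k + 1) - w i (2 * k + 1) * w j (2 * k)
          + smult ?c (x k i * y k j - y k i * x k j))"
      using xy[of _ ?c] that by auto
    then obtain u v where u: "\<And>k. k < s \<Longrightarrow> deg_le_on m (u k) (d div 2)"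
      and v: "\<And>k. k < s \<Longrightarrow> deg_le_on m (v k) ((d + 1) div 2)"
      and uv: "\<And>k i j. k < s \<Longrightarrow> u k i * v k j - v k i * u k j =
          w i (2 * k) * w j (2 * k + 1) - w i (2 * k + 1) * w j (2 * k)
          + smult ?c (x k i * y k j - y k i * x k j)"
      by metis
    define u' where "u' k = (if k < s then u k else (\<lambda>_. 0))" for k
    define v' where "v' k = (if k < s then v k else (\<lambda>_. 0))" for k
    have smult_sum: "smult e (\<Sum>k<s. f k) = (\<Sum>k<s. smult e (f k))" for e and f :: "nat \<Rightarrow> complex poly"
      by (induction s) (simp_all add: smult_add_right)
    have "wedge r u' v' i j = P $$ (i, j) + smult ?c (wedge s x y i j)" if "i < m" "j < m" for i j
    proof -
      have "wedge r u' v' i j = (\<Sum>k<s. u k i * v k j - v k i * u k j)"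
        unfolding wedge_def using s by (intro sum.mono_neutral_cong_right) (auto simp: u'_def v'_def)
      also have "\<dots> = P $$ (i, j) + smult ?c (wedge s x y i j)"
        by (simp add: uv P_eq[OF that] wedge_def sum.distrib smult_sum)
      finally show ?thesis .
    qed
    moreover have "\<forall>k<r. deg_le_on m (u' k) (d div 2)" "\<forall>k<r. deg_le_on m (v' k) ((d + 1) div 2)"
      using u v by (auto simp: u'_def v'_def deg_le_on_def)
    ultimately show ?thesis
      by (intro G_ssI[of _ m r u' d v']) (simp_all add: Q_def)
  qed
  show "P \<in> pol_closure d m (G_ss d r m)"
  proof (rule in_pol_closure_if_perturbation[OF P_ss])
    fix \<epsilon> :: real assume "0 < \<epsilon>"
    then show "Q \<epsilon> \<in> G_ss d r m \<and> Q \<epsilon> \<in> POL_ss d m"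
      using Q_G G_ss_subset_POL_ss by blast
  next
    fix \<epsilon> :: real and i j assume "i < m" "j < m"
    then show "Q \<epsilon> $$ (i, j) = P $$ (i, j) + smult (complex_of_real \<epsilon>) (wedge s x y i j)
        + smult (complex_of_real \<epsilon> ^ 2) 0"
      by (simp add: Q_def)
  qed
qed

theorem theorem3p8:
  fixes m r d :: nat
  assumes "d \<ge> 1" and "2 \<le> 2 * r" and "2 * r \<le> m - 1"
  shows "pol_closure d m (A_ss d m (replicate r (nat \<lceil>real d / 2\<rceil>))) = pol_closure d m (G_ss d r m)
    \<and> pol_closure d m (G_ss d r m) = POL_ss_rank d (2 * r) m"
proof -
  let ?A = "A_ss d m (replicate r ((d + 1) div 2))" and ?G = "G_ss d r m" and ?R = "POL_ss_rank d (2 * r) m"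
  have mono: "pol_closure d m S \<subseteq> pol_closure d m T" if "S \<subseteq> T" for S T
    using that unfolding pol_closure_def by (rule closure_of_mono)
  have idem: "pol_closure d m (pol_closure d m S) = pol_closure d m S" for S
    unfolding pol_closure_def by (rule closure_of_closure_of)
  have "0 < m" using assms by linarith
  then have "pol_closure d m ?G \<subseteq> pol_closure d m ?A"
    using mono[OF G_ss_subset_closure_A_ss] idem by blast
  moreover have "pol_closure d m ?A \<subseteq> pol_closure d m ?G"
    by (rule mono[OF A_ss_subset_G_ss])
  moreover have "pol_closure d m ?G \<subseteq> ?R"
    using mono[OF G_ss_subset_POL_ss_rank] POL_ss_rank_closed by blast
  moreover have "?R \<subseteq> pol_closure d m ?G"
    by (rule POL_ss_rank_subset_closure_G_ss)
  ultimately show ?thesis unfolding nat_half by blast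
qed

end
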